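(* Let $k$ be an algebraically closed field and let $I\subset R=k[x_0,x_1,x_2]$, generated in degree $d\geq 2$, be the base ideal of a plane Cremona map of degree $d$ without fixed part. If $d\leq 4$, then $I$ is saturated.
   Context: $R$ is standard graded. A plane Cremona map of degree $d$ without fixed part is a birational map $\mathbb P^2\dashrightarrow\mathbb P^2$ given by three forms of degree $d$ with no nontrivial common factor; its base ideal $I$ is the ideal generated by these three forms. $I$ is saturated if $I=I:(x_0,x_1,x_2)^{\infty}$. *)

theory Defs
  imports
    "HOL-Library.Poly_Mapping"
    "HOL-Library.Numeral_Type"
    "HOL-Computational_Algebra.Polynomial"
begin

text \<open>
  The ring \<open>R = k[x\<^sub>0, x\<^sub>1, x\<^sub>2]\<close> is the monoid algebra of exponent vectors \<open>3 \<Rightarrow>\<^sub>0 nat\<close>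
  with its convolution product; the variables are indexed by \<open>0, 1, 2 :: 3\<close>.
\<close>

type_synonym 'k poly3 = "(3 \<Rightarrow>\<^sub>0 nat) \<Rightarrow>\<^sub>0 'k"

definition Var :: "3 \<Rightarrow> 'k::comm_ring_1 poly3"
  where "Var i = Poly_Mapping.single (Poly_Mapping.single i 1) 1"

definition Const :: "'k::comm_ring_1 \<Rightarrow> 'k poly3"
  where "Const c = Poly_Mapping.single 0 c"

definition mon_degree :: "(3 \<Rightarrow>\<^sub>0 nat) \<Rightarrow> nat"
  where "mon_degree m = (\<Sum>i\<in>UNIV. Poly_Mapping.lookup m i)"

text \<open>Standard grading; the zero polynomial is a form of every degree.\<close>

definition is_form :: "nat \<Rightarrow> 'k::comm_ring_1 poly3 \<Rightarrow> bool"
  where "is_form d p \<longleftrightarrow> (\<forall>m\<in>Poly_Mapping.keys p. mon_degree m = d)"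

text \<open>The polynomial \<open>p(f\<^sub>0, f\<^sub>1, f\<^sub>2)\<close>.\<close>

definition subst3 :: "(3 \<Rightarrow> 'k::comm_ring_1 poly3) \<Rightarrow> 'k poly3 \<Rightarrow> 'k poly3"
  where "subst3 f p = (\<Sum>m\<in>Poly_Mapping.keys p. Const (Poly_Mapping.lookup p m) * (\<Prod>i\<in>UNIV. f i ^ Poly_Mapping.lookup m i))"

text \<open>
  A rational map \<open>\<P>\<^sup>2 \<rightarrow> \<P>\<^sup>2\<close> is represented by a nonzero triple of forms of one common degree.
  Two such triples represent the same rational map iff they are proportional over the
  fraction field, i.e. iff all their \<open>2 \<times> 2\<close> minors vanish.
\<close>

definition represents_rational_map :: "nat \<Rightarrow> (3 \<Rightarrow> 'k::comm_ring_1 poly3) \<Rightarrow> bool"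
  where "represents_rational_map d f \<longleftrightarrow> (\<forall>i. is_form d (f i)) \<and> (\<exists>i. f i \<noteq> 0)"

definition same_rational_map :: "(3 \<Rightarrow> 'k::comm_ring_1 poly3) \<Rightarrow> (3 \<Rightarrow> 'k poly3) \<Rightarrow> bool"
  where "same_rational_map f g \<longleftrightarrow> (\<forall>i j. f i * g j = f j * g i)"

definition compose3 :: "(3 \<Rightarrow> 'k::comm_ring_1 poly3) \<Rightarrow> (3 \<Rightarrow> 'k poly3) \<Rightarrow> (3 \<Rightarrow> 'k poly3)"
  where "compose3 g f = (\<lambda>i. subst3 f (g i))"

text \<open>
  The composite \<open>g \<circ> f\<close> is defined as a rational map iff the composed triple is not identically
  zero (the image of \<open>f\<close> is not contained in the base locus of \<open>g\<close>). The triple \<open>Var\<close>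
  represents the identity.
\<close>

definition left_inverse_rational_map ::
    "(3 \<Rightarrow> 'k::comm_ring_1 poly3) \<Rightarrow> (3 \<Rightarrow> 'k poly3) \<Rightarrow> bool"
  where "left_inverse_rational_map g f \<longleftrightarrow>
    (\<exists>i. compose3 g f i \<noteq> 0) \<and> same_rational_map (compose3 g f) Var"

definition birational :: "(3 \<Rightarrow> 'k::comm_ring_1 poly3) \<Rightarrow> bool"
  where "birational f \<longleftrightarrow> (\<exists>e g. represents_rational_map e g \<and>
    left_inverse_rational_map g f \<and> left_inverse_rational_map f g)"

definition no_fixed_part :: "(3 \<Rightarrow> 'k::comm_ring_1 poly3) \<Rightarrow> bool"
  where "no_fixed_part f \<longleftrightarrow> (\<forall>h. (\<forall>i. h dvd f i) \<longrightarrow> h dvd 1)"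

definition plane_cremona_map :: "nat \<Rightarrow> (3 \<Rightarrow> 'k::field poly3) \<Rightarrow> bool"
  where "plane_cremona_map d f \<longleftrightarrow>
    represents_rational_map d f \<and> birational f \<and> no_fixed_part f"

text \<open>Ideals of a commutative ring are the submodules of the ring over itself.\<close>

definition ideal_generated :: "'a::comm_ring_1 set \<Rightarrow> 'a set"
  where "ideal_generated S = module.span (*) S"

fun ideal_power :: "'a::comm_ring_1 set \<Rightarrow> nat \<Rightarrow> 'a set"
  where
    "ideal_power I 0 = UNIV"
  | "ideal_power I (Suc n) = ideal_generated {a * b | a b. a \<in> I \<and> b \<in> ideal_power I n}"

definition ideal_colon :: "'a::comm_ring_1 set \<Rightarrow> 'a set \<Rightarrow> 'a set"
  where "ideal_colon I J = {r. \<forall>a\<in>J. r * a \<in> I}"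

definition ideal_saturation :: "'a::comm_ring_1 set \<Rightarrow> 'a set \<Rightarrow> 'a set"
  where "ideal_saturation I J = (\<Union>n. ideal_colon I (ideal_power J n))"

definition base_ideal :: "(3 \<Rightarrow> 'k::field poly3) \<Rightarrow> 'k poly3 set"
  where "base_ideal f = ideal_generated (range f)"

definition saturated :: "'k::field poly3 set \<Rightarrow> bool"
  where "saturated I \<longleftrightarrow> I = ideal_saturation I (ideal_generated (range Var))"

end

theory Submission
  imports Defs "HOL-Computational_Algebra.Field_as_Ring" "HOL-Computational_Algebra.Polynomial_Factorial"
begin

text \<open>
  Let \<open>I\<close> be the ideal of the three forms \<open>f\<^sub>0, f\<^sub>1, f\<^sub>2\<close> of degree \<open>d\<close>. The proof controls the
  saturation degree by degree: low degrees by the Cremona property, the remaining ones by restriction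
  to a line that misses the base points.

  Degrees up to \<open>d\<close> (\<open>plane_cremona_map_complete_net\<close>). A homaloidal net is a complete linear
  system. Algebraically: if \<open>g\<close> is the inverse map, then \<open>f\<^sub>i(g) = D x\<^sub>i\<close> for one form \<open>D\<close>. When \<open>h\<close> is
  a form of degree \<open>d\<close> in the saturation, a power of every \<open>g\<^sub>i\<close> multiplies \<open>h(g)\<close> into the ideal
  of \<open>D\<close>. After removal of the common factor of the \<open>g\<^sub>i\<close> this forces \<open>D\<close> to divide \<open>h(g)\<close>; the
  quotient is a linear form \<open>\<Sum> c\<^sub>i x\<^sub>i\<close>, so \<open>h\<close> and \<open>\<Sum> c\<^sub>i f\<^sub>i\<close> have the same pullback by the dominant
  map \<open>g\<close> and agree. A nonzero form of smaller degree in the saturation would yield a common factor of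
  the \<open>f\<^sub>i\<close>.

  A line (\<open>exists_line_free_coordinates\<close>). Since the \<open>f\<^sub>i\<close> have no common factor, there are only
  finitely many base points, and in suitable coordinates the line \<open>x\<^sub>2 = 0\<close> contains none of them.
  Then \<open>x\<^sub>2 h\<close> lies in the saturation only if \<open>h\<close> does (\<open>sat_mem_cancel_Var_2\<close>).

  The restrictions of the \<open>f\<^sub>i\<close> to this line, multiplied by \<open>x\<^sub>0\<close> and by \<open>x\<^sub>1\<close>, are six binary forms of
  degree \<open>d + 1\<close>, in a space of dimension \<open>d + 2 \<le> 6\<close>; this is where \<open>d \<le> 4\<close> enters
  (\<open>linear_syzygy_or_all_forms\<close>). If they span that space, every form of degree greater than \<open>d\<close> is
  congruent modulo \<open>I\<close> to a multiple of \<open>x\<^sub>2\<close>, and division by \<open>x\<^sub>2\<close> leads down to degree \<open>d\<close>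
  (\<open>saturated_if_all_forms\<close>). Otherwise there is a linear syzygy on the line. It lifts to the plane
  because the saturation agrees with \<open>I\<close> in degree \<open>d\<close>, and a linear syzygy makes the \<open>f\<^sub>i\<close> the
  maximal minors of a matrix with two columns (\<open>hilbert_burch\<close>). As in the Hilbert-Burch theorem,
  \<open>x\<^sub>2\<close> is then not a zero divisor modulo \<open>I\<close>, and \<open>I\<close> is saturated.
\<close>

section \<open>Polynomials in three variables\<close>

lemma UNIV_3: "(UNIV :: 3 set) = {0, 1, 2}"
proof -
  have "card {0, 1, 2 :: 3} = card (UNIV :: 3 set)" by simp
  from card_subset_eq[OF finite subset_UNIV this] show ?thesis
    by (rule sym)
qed

lemma sum_UNIV_3: "(\<Sum>i\<in>(UNIV :: 3 set). f i) = f 0 + f 1 + (f 2 :: 'a::comm_monoid_add)"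
  unfolding UNIV_3 by (simp add: add.assoc)

lemma prod_UNIV_3: "(\<Prod>i\<in>(UNIV :: 3 set). f i) = f 0 * f 1 * (f 2 :: 'a::comm_monoid_mult)"
  unfolding UNIV_3 by (simp add: mult.assoc)

lemma exhaust_3: "(i :: 3) = 0 \<or> i = 1 \<or> i = 2"
  using UNIV_3 by blast

abbreviation coeff3 :: "'k::zero poly3 \<Rightarrow> (3 \<Rightarrow>\<^sub>0 nat) \<Rightarrow> 'k"
  where "coeff3 p m \<equiv> Poly_Mapping.lookup p m"

abbreviation expo :: "(3 \<Rightarrow>\<^sub>0 nat) \<Rightarrow> 3 \<Rightarrow> nat"
  where "expo m i \<equiv> Poly_Mapping.lookup m i"

locale ring_morphism =
  fixes \<phi> :: "'a::comm_ring_1 \<Rightarrow> 'b::comm_ring_1"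
  assumes one [simp]: "\<phi> 1 = 1"
    and add [simp]: "\<phi> (a + b) = \<phi> a + \<phi> b"
    and mult [simp]: "\<phi> (a * b) = \<phi> a * \<phi> b"
begin

lemma zero [simp]: "\<phi> 0 = 0"
  by (metis add add_cancel_left_left)

lemma uminus [simp]: "\<phi> (- a) = - \<phi> a"
  by (metis add zero add.right_inverse add_eq_0_iff)

lemma diff [simp]: "\<phi> (a - b) = \<phi> a - \<phi> b"
  by (metis add uminus diff_conv_add_uminus)

lemma power [simp]: "\<phi> (a ^ n) = \<phi> a ^ n"
  by (induction n) simp_all

lemma sum [simp]: "\<phi> (\<Sum>i\<in>A. f i) = (\<Sum>i\<in>A. \<phi> (f i))"
  by (induction A rule: infinite_finite_induct) simp_all

lemma dvd: "a dvd b \<Longrightarrow> \<phi> a dvd \<phi> b"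
  by (metis dvd_def mult)

end

lemma ring_morphism_comp:
  "ring_morphism \<phi> \<Longrightarrow> ring_morphism \<psi> \<Longrightarrow> ring_morphism (\<lambda>x. \<phi> (\<psi> x))"
  by (simp add: ring_morphism_def)

definition eval3 :: "('a::comm_ring_1 \<Rightarrow> 'b::comm_ring_1) \<Rightarrow> (3 \<Rightarrow> 'b) \<Rightarrow> 'a poly3 \<Rightarrow> 'b"
  where "eval3 h v p = (\<Sum>m\<in>Poly_Mapping.keys p. h (coeff3 p m) * (\<Prod>i\<in>UNIV. v i ^ expo m i))"

lemma subst3_eq_eval3: "subst3 f = eval3 Const f"
  by (simp add: fun_eq_iff subst3_def eval3_def)

lemma sum_monomials:
  "(p :: 'a::comm_ring_1 poly3) = (\<Sum>m\<in>Poly_Mapping.keys p. Poly_Mapping.single m (coeff3 p m))"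
  by (rule poly_mapping_eqI)
     (auto simp: lookup_sum lookup_single when_def in_keys_iff)

lemma monomial_induct [case_names monomial add]:
  fixes p :: "'a::comm_ring_1 poly3"
  assumes "\<And>m c. P (Poly_Mapping.single m c)" "\<And>p q. P p \<Longrightarrow> P q \<Longrightarrow> P (p + q)"
  shows "P p"
proof -
  have "P (\<Sum>m\<in>K. Poly_Mapping.single m (c m))" if "finite K" for K and c :: "_ \<Rightarrow> 'a"
    using that
  proof (induction K rule: finite_induct)
    case empty
    then show ?case using assms(1)[of 0 0] by simp
  qed (use assms in simp)
  then show ?thesis
    using sum_monomials[of p] by (metis finite_keys)
qed

lemma eval3_superset:
  assumes "h 0 = 0" "finite K" "Poly_Mapping.keys p \<subseteq> K"
  shows "eval3 h v p = (\<Sum>m\<in>K. h (coeff3 p m) * (\<Prod>i\<in>UNIV. v i ^ expo m i))"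
  unfolding eval3_def
  by (rule sum.mono_neutral_left) (use assms in \<open>auto simp: in_keys_iff\<close>)

lemma eval3_single:
  assumes "h 0 = 0"
  shows "eval3 h v (Poly_Mapping.single m c) = h c * (\<Prod>i\<in>UNIV. v i ^ expo m i)"
  using eval3_superset[of h "{m}" "Poly_Mapping.single m c" v] assms by simp

lemma ring_morphism_eval3:
  assumes "ring_morphism h"
  shows "ring_morphism (eval3 h v)"
proof -
  interpret h: ring_morphism h by fact
  have add: "eval3 h v (p + q) = eval3 h v p + eval3 h v q" for p q
  proof -
    let ?K = "Poly_Mapping.keys p \<union> Poly_Mapping.keys q"
    have "eval3 h v r = (\<Sum>m\<in>?K. h (coeff3 r m) * (\<Prod>i\<in>UNIV. v i ^ expo m i))"
      if "Poly_Mapping.keys r \<subseteq> ?K" for r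
      by (rule eval3_superset) (use that in auto)
    from this[of p] this[of q] this[of "p + q"] show ?thesis
      by (simp add: Poly_Mapping.keys_add lookup_add algebra_simps sum.distrib)
  qed
  have single: "eval3 h v (Poly_Mapping.single m c * q)
      = eval3 h v (Poly_Mapping.single m c) * eval3 h v q" for m c q
  proof (induction q rule: monomial_induct)
    case (monomial n d)
    show ?case
      by (simp add: mult_single eval3_single lookup_add power_add prod.distrib algebra_simps)
  qed (simp add: algebra_simps add)
  have "eval3 h v (p * q) = eval3 h v p * eval3 h v q" for p q
    by (induction p rule: monomial_induct) (simp_all add: single distrib_right add)
  moreover have "eval3 h v 1 = 1"
    using eval3_single[of h v 0 1] by simp
  ultimately show ?thesis
    by unfold_locales (simp_all add: add)
qed

lemma ring_morphism_Const: "ring_morphism (Const :: 'k::comm_ring_1 \<Rightarrow> _)"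
  by unfold_locales (simp_all add: Const_def single_add mult_single)

lemmas ring_morphism_subst3 = ring_morphism_eval3[OF ring_morphism_Const, folded subst3_eq_eval3]

interpretation Const: ring_morphism "Const :: 'k::comm_ring_1 \<Rightarrow> _"
  by (rule ring_morphism_Const)

interpretation subst3: ring_morphism "subst3 f" for f :: "3 \<Rightarrow> 'k::comm_ring_1 poly3"
  by (rule ring_morphism_subst3)

lemma Const_eq_0_iff [simp]: "Const c = 0 \<longleftrightarrow> c = 0"
  by (metis Const_def single_zero inj_single injD)

lemma coeff3_Const_mult [simp]: "coeff3 (Const a * p) m = a * coeff3 p m"
  by (induction p rule: monomial_induct)
     (simp_all add: Const_def mult_single lookup_single when_def lookup_add algebra_simps)

lemma Var_power: "Var i ^ n = Poly_Mapping.single (Poly_Mapping.single i n) 1"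
  by (induction n) (simp_all add: Var_def mult_single single_add[symmetric])

lemma monomial_eq_prod:
  "Poly_Mapping.single m (1 :: 'k::comm_ring_1) = (\<Prod>i\<in>UNIV. Var i ^ expo m i)"
proof -
  have "(\<Prod>i\<in>A. Poly_Mapping.single (Poly_Mapping.single i (expo m i)) 1)
      = Poly_Mapping.single (\<Sum>i\<in>A. Poly_Mapping.single i (expo m i)) (1::'k)" for A
    by (induction A rule: infinite_finite_induct) (simp_all add: mult_single)
  moreover have "(\<Sum>i\<in>UNIV. Poly_Mapping.single i (expo m i)) = m"
    by (rule poly_mapping_eqI) (simp add: lookup_sum lookup_single when_def)
  ultimately show ?thesis
    by (simp add: Var_power)
qed

lemma monomial_eq_Const_mult: "Poly_Mapping.single m c = Const c * Poly_Mapping.single m 1"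
  by (simp add: Const_def mult_single)

lemma poly3_induct [case_names Const Var add mult]:
  fixes p :: "'k::comm_ring_1 poly3"
  assumes "\<And>c. P (Const c)" "\<And>i. P (Var i)"
    and "\<And>p q. P p \<Longrightarrow> P q \<Longrightarrow> P (p + q)" "\<And>p q. P p \<Longrightarrow> P q \<Longrightarrow> P (p * q)"
  shows "P p"
proof (induction p rule: monomial_induct)
  case (monomial m c)
  have one: "P 1" using assms(1)[of 1] by simp
  have "P (Var i ^ n)" for i n
    by (induction n) (use one assms in auto)
  then show ?case
    unfolding monomial_eq_Const_mult[of m c] monomial_eq_prod prod_UNIV_3
    by (intro assms)
qed (use assms in simp)

lemma eval3_Const [simp]: "ring_morphism h \<Longrightarrow> eval3 h v (Const c) = h c"
  by (simp add: Const_def eval3_single ring_morphism.zero)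

lemma eval3_Var [simp]: "ring_morphism h \<Longrightarrow> eval3 h v (Var i) = v i"
  using exhaust_3[of i]
  by (auto simp: Var_def eval3_single ring_morphism.zero ring_morphism.one prod_UNIV_3 lookup_single)

lemma subst3_Const [simp]: "subst3 f (Const c) = Const c"
  by (simp add: subst3_eq_eval3 ring_morphism_Const)

lemma subst3_Var [simp]: "subst3 f (Var i) = f i"
  by (simp add: subst3_eq_eval3 ring_morphism_Const)

lemma ring_morphism_eqI:
  assumes "ring_morphism \<phi>" "ring_morphism \<psi>"
    and "\<And>c. \<phi> (Const c) = \<psi> (Const c)" "\<And>i. \<phi> (Var i) = \<psi> (Var i)"
  shows "\<phi> p = \<psi> (p :: 'k::comm_ring_1 poly3)"
  by (induction p rule: poly3_induct)
     (simp_all add: assms ring_morphism.add[OF assms(1)] ring_morphism.add[OF assms(2)]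
        ring_morphism.mult[OF assms(1)] ring_morphism.mult[OF assms(2)])

lemma subst3_subst3: "subst3 f (subst3 g p) = subst3 (\<lambda>i. subst3 f (g i)) p"
  by (rule ring_morphism_eqI[where \<phi> = "\<lambda>p. subst3 f (subst3 g p)"])
     (auto intro: ring_morphism_comp ring_morphism_subst3)

lemma subst3_ident [simp]: "subst3 Var p = p"
  by (rule ring_morphism_eqI[of "subst3 Var" "\<lambda>p. p"])
     (auto intro: ring_morphism_subst3 simp: ring_morphism_def)

subsection \<open>Forms\<close>

lemma mon_degree_add: "mon_degree (m + n) = mon_degree m + mon_degree n"
  by (simp add: mon_degree_def lookup_add sum.distrib)

lemma mon_degree_eq: "mon_degree m = expo m 0 + expo m 1 + expo m 2"
  by (simp add: mon_degree_def sum_UNIV_3)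

lemma is_form_iff: "is_form d p \<longleftrightarrow> (\<forall>m. coeff3 p m \<noteq> 0 \<longrightarrow> mon_degree m = d)"
  by (auto simp: is_form_def in_keys_iff)

lemma is_form_0 [simp]: "is_form d 0"
  by (simp add: is_form_def)

lemma is_form_add: "is_form d p \<Longrightarrow> is_form d q \<Longrightarrow> is_form d (p + q)"
  unfolding is_form_iff lookup_add by (metis add.right_neutral)

lemma is_form_uminus: "is_form d p \<Longrightarrow> is_form d (- p)"
  by (simp add: is_form_iff)

lemma is_form_diff: "is_form d p \<Longrightarrow> is_form d q \<Longrightarrow> is_form d (p - q)"
  using is_form_add[of d p "- q"] is_form_uminus[of d q] by simp

lemma is_form_mult: "is_form d p \<Longrightarrow> is_form e q \<Longrightarrow> is_form (d + e) (p * q)"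
  unfolding is_form_def using keys_mult[of p q] by (fastforce simp: mon_degree_add)

lemma is_form_sum: "(\<And>i. i \<in> A \<Longrightarrow> is_form d (f i)) \<Longrightarrow> is_form d (\<Sum>i\<in>A. f i)"
  by (induction A rule: infinite_finite_induct) (auto intro: is_form_add)

lemma is_form_Const [simp]: "is_form 0 (Const c)"
  by (auto simp: is_form_def Const_def mon_degree_def split: if_splits)

lemma is_form_Const_mult: "is_form d p \<Longrightarrow> is_form d (Const c * p)"
  using is_form_mult[of 0 "Const c" d p] by simp

lemma is_form_single: "mon_degree m = d \<Longrightarrow> is_form d (Poly_Mapping.single m c)"
  by (auto simp: is_form_def split: if_splits)

lemma is_form_Var [simp]: "is_form (Suc 0) (Var i)"
  using exhaust_3[of i] by (auto simp: Var_def is_form_def mon_degree_eq lookup_single)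

lemma is_form_1 [simp]: "is_form 0 1"
  using is_form_Const[of 1] by simp

lemma is_form_power: "is_form d p \<Longrightarrow> is_form (d * n) (p ^ n)"
  by (induction n) (simp_all add: is_form_mult)

lemma is_form_Var_power [simp]: "is_form n (Var i ^ n)"
  using is_form_power[of "Suc 0" "Var i" n] by simp

lemma form_induct:
  assumes "is_form d (p :: 'k::comm_ring_1 poly3)"
    and "P 0" "\<And>p q. P p \<Longrightarrow> P q \<Longrightarrow> P (p + q)"
    and "\<And>m c. mon_degree m = d \<Longrightarrow> P (Const c * Poly_Mapping.single m 1)"
  shows "P p"
proof -
  have "P (\<Sum>m\<in>K. Poly_Mapping.single m (coeff3 p m))"
    if "finite K" "K \<subseteq> Poly_Mapping.keys p" for K
    using that
  proof (induction K rule: finite_induct)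
    case (insert m K)
    then have "mon_degree m = d" using assms(1) by (auto simp: is_form_def)
    then have "P (Poly_Mapping.single m (coeff3 p m))"
      using assms(4)[of m "coeff3 p m"] by (simp add: Const_def mult_single)
    with insert show ?case using assms(3) by simp
  qed (use assms in simp)
  from this[of "Poly_Mapping.keys p"] show ?thesis
    by (simp add: sum_monomials[symmetric])
qed

lemma is_form_subst3:
  assumes "is_form d p" "\<And>i. is_form e (f i)"
  shows "is_form (d * e) (subst3 f p)"
  using assms(1)
proof (rule form_induct)
  fix m c assume m: "mon_degree m = d"
  have "is_form (e * expo m 0 + e * expo m 1 + e * expo m 2)
      (f 0 ^ expo m 0 * f 1 ^ expo m 1 * f 2 ^ expo m 2)"
    by (intro is_form_mult is_form_power assms(2))
  also have "f 0 ^ expo m 0 * f 1 ^ expo m 1 * f 2 ^ expo m 2 = subst3 f (Poly_Mapping.single m 1)"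
    by (simp add: monomial_eq_prod prod_UNIV_3)
  finally show "is_form (d * e) (subst3 f (Const c * Poly_Mapping.single m 1))"
    by (simp add: m[symmetric] mon_degree_eq distrib_left distrib_right mult.commute is_form_Const_mult)
qed (auto intro: is_form_add)

definition form_part :: "nat \<Rightarrow> 'k::comm_ring_1 poly3 \<Rightarrow> 'k poly3"
  where "form_part d p = (\<Sum>m\<in>{m \<in> Poly_Mapping.keys p. mon_degree m = d}.
    Poly_Mapping.single m (coeff3 p m))"

lemma coeff3_form_part: "coeff3 (form_part d p) m = (if mon_degree m = d then coeff3 p m else 0)"
  by (simp add: form_part_def lookup_sum lookup_single when_def in_keys_iff)

lemma form_part_add: "form_part d (p + q) = form_part d p + form_part d q"
  by (rule poly_mapping_eqI) (simp add: coeff3_form_part lookup_add)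

lemma form_part_diff: "form_part d (p - q) = form_part d p - form_part d q"
  by (rule poly_mapping_eqI) (simp add: coeff3_form_part lookup_minus)

lemma form_part_0 [simp]: "form_part d 0 = 0"
  by (simp add: form_part_def)

lemma form_part_sum: "form_part d (\<Sum>i\<in>A. f i) = (\<Sum>i\<in>A. form_part d (f i))"
  by (induction A rule: infinite_finite_induct) (simp_all add: form_part_add)

lemma is_form_form_part [simp]: "is_form d (form_part d p)"
  by (simp add: is_form_iff coeff3_form_part)

lemma form_part_form: "is_form e p \<Longrightarrow> form_part d p = (if d = e then p else 0)"
  by (auto intro!: poly_mapping_eqI simp: coeff3_form_part is_form_iff)

lemma sum_form_parts: "(p :: 'k::comm_ring_1 poly3) = (\<Sum>d\<in>mon_degree ` Poly_Mapping.keys p. form_part d p)"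
  by (rule poly_mapping_eqI) (auto simp: lookup_sum coeff3_form_part in_keys_iff)

lemma form_part_mult:
  assumes "is_form e q"
  shows "form_part (d + e) (p * q) = form_part d p * q"
proof (induction p rule: monomial_induct)
  case (monomial m c)
  have "is_form (mon_degree m + e) (Poly_Mapping.single m c * q)"
    by (intro is_form_mult is_form_single assms refl)
  then show ?case
    by (auto simp: form_part_form[of "mon_degree m"] form_part_form[of "mon_degree m + e"] is_form_single)
qed (simp add: form_part_add algebra_simps)

lemma form_part_mult_less:
  assumes "is_form e q" "d < e"
  shows "form_part d (p * q) = 0"
proof (induction p rule: monomial_induct)
  case (monomial m c)
  have "is_form (mon_degree m + e) (Poly_Mapping.single m c * q)"
    by (intro is_form_mult is_form_single assms refl)
  then show ?case using assms(2)
    by (auto simp: form_part_form[of "mon_degree m + e"])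
qed (simp add: form_part_add algebra_simps)

lemma is_form_0_Const: "is_form 0 p \<Longrightarrow> p = Const (coeff3 p 0)"
proof (rule poly_mapping_eqI)
  fix m assume "is_form 0 p"
  moreover have "mon_degree m = 0 \<Longrightarrow> m = 0"
    by (rule poly_mapping_eqI) (simp add: mon_degree_eq, metis exhaust_3)
  ultimately show "coeff3 p m = coeff3 (Const (coeff3 p 0)) m"
    by (auto simp: is_form_iff Const_def lookup_single when_def)
qed

lemma is_form_unit:
  assumes "is_form d (p :: 'k::field poly3)" "p dvd 1"
  shows "d = 0"
proof (rule ccontr)
  assume "d \<noteq> 0"
  from assms(2) obtain q where q: "1 = q * p" by (metis dvdE mult.commute)
  have "form_part 0 (q * p) = 0"
    by (rule form_part_mult_less) (use assms \<open>d \<noteq> 0\<close> in auto)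
  moreover have "form_part 0 (1 :: 'k poly3) = 1"
    by (simp add: form_part_form[of 0])
  ultimately show False using q by simp
qed

lemma linear_form_eq:
  assumes "is_form (Suc 0) p"
  obtains c where "p = (\<Sum>i\<in>UNIV. Const (c i) * Var i)"
proof -
  have "\<exists>c. p = (\<Sum>i\<in>UNIV. Const (c i) * Var i)"
    using assms
  proof (rule form_induct)
    show "\<exists>c. 0 = (\<Sum>i\<in>UNIV. Const (c i) * Var i :: 'a poly3)"
      by (rule exI[of _ "\<lambda>_. 0"]) simp
  next
    fix p q :: "'a poly3"
    assume "\<exists>c. p = (\<Sum>i\<in>UNIV. Const (c i) * Var i)" "\<exists>c. q = (\<Sum>i\<in>UNIV. Const (c i) * Var i)"
    then obtain c d where "p = (\<Sum>i\<in>UNIV. Const (c i) * Var i)" "q = (\<Sum>i\<in>UNIV. Const (d i) * Var i)"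
      by blast
    then show "\<exists>c. p + q = (\<Sum>i\<in>UNIV. Const (c i) * Var i)"
      by (intro exI[of _ "\<lambda>i. c i + d i"]) (simp add: sum.distrib algebra_simps)
  next
    fix m and b :: 'a assume "mon_degree m = Suc 0"
    then have "expo m 0 = 1 \<and> expo m 1 = 0 \<and> expo m 2 = 0 \<or> expo m 0 = 0 \<and> expo m 1 = 1 \<and> expo m 2 = 0
        \<or> expo m 0 = 0 \<and> expo m 1 = 0 \<and> expo m 2 = 1"
      by (auto simp: mon_degree_eq)
    then show "\<exists>c. Const b * Poly_Mapping.single m 1 = (\<Sum>i\<in>UNIV. Const (c i) * Var i)"
      unfolding monomial_eq_prod prod_UNIV_3 sum_UNIV_3
      apply (elim disjE)
      subgoal by (intro exI[of _ "(\<lambda>_. 0)(0 := b)"]) simp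
      subgoal by (intro exI[of _ "(\<lambda>_. 0)(1 := b)"]) simp
      subgoal by (intro exI[of _ "(\<lambda>_. 0)(2 := b)"]) simp
      done
  qed
  then show thesis using that by blast
qed

subsection \<open>Setting variables to zero\<close>

lemma diff_subst3:
  "\<exists>c. p - subst3 v p = (\<Sum>i\<in>UNIV. c i * (Var i - v i))"
proof (induction p rule: poly3_induct)
  case (Const c)
  then show ?case by (intro exI[of _ "\<lambda>_. 0"]) simp
next
  case (Var i)
  show ?case
    using exhaust_3[of i]
    by (intro exI[of _ "\<lambda>j. if j = i then 1 else 0"]) (auto simp: sum_UNIV_3)
next
  case (add p q)
  then obtain c d where "p - subst3 v p = (\<Sum>i\<in>UNIV. c i * (Var i - v i))"
    "q - subst3 v q = (\<Sum>i\<in>UNIV. d i * (Var i - v i))" by blast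
  moreover have "(p + q) - subst3 v (p + q) = (p - subst3 v p) + (q - subst3 v q)"
    by simp
  ultimately have "(p + q) - subst3 v (p + q) = (\<Sum>i\<in>UNIV. (c i + d i) * (Var i - v i))"
    by (simp only: sum.distrib distrib_right)
  then show ?case by (rule exI[of _ "\<lambda>i. c i + d i"])
next
  case (mult p q)
  then obtain c d where cd: "p - subst3 v p = (\<Sum>i\<in>UNIV. c i * (Var i - v i))"
    "q - subst3 v q = (\<Sum>i\<in>UNIV. d i * (Var i - v i))" by blast
  have "(p * q) - subst3 v (p * q) = p * (q - subst3 v q) + subst3 v q * (p - subst3 v p)"
    by (simp add: algebra_simps)
  also have "\<dots> = (\<Sum>i\<in>UNIV. (p * d i + subst3 v q * c i) * (Var i - v i))"
    by (simp only: cd sum_distrib_left sum.distrib distrib_right mult.assoc)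
  finally show ?case by (rule exI[of _ "\<lambda>i. p * d i + subst3 v q * c i"])
qed

abbreviation kill :: "3 \<Rightarrow> 'k::comm_ring_1 poly3 \<Rightarrow> 'k poly3"
  where "kill i \<equiv> subst3 (Var(i := 0))"

lemma kill_decomp: obtains c where "p = kill i p + Var i * c"
proof -
  obtain c where "p - kill i p = (\<Sum>j\<in>UNIV. c j * (Var j - (Var(i := 0)) j))"
    using diff_subst3 by blast
  also have "\<dots> = Var i * c i"
    using exhaust_3[of i] by (auto simp: sum_UNIV_3)
  finally have "p = kill i p + Var i * c i" by (metis add.commute diff_add_cancel)
  then show thesis by (rule that)
qed

lemma Var_dvd_iff: "Var i dvd p \<longleftrightarrow> kill i p = 0"
proof
  assume "kill i p = 0"
  moreover obtain c where "p = kill i p + Var i * c" by (rule kill_decomp)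
  ultimately have "p = Var i * c" by simp
  then show "Var i dvd p" by (rule dvdI)
qed (auto elim!: dvdE)

lemma kill_kill [simp]: "kill i (kill i p) = kill i p"
  unfolding subst3_subst3 by (rule arg_cong[where f = "\<lambda>v. subst3 v p"]) auto

lemma Var_neq_0 [simp]: "Var i \<noteq> (0 :: 'k::comm_ring_1 poly3)"
  by (metis Var_def inj_single injD single_zero zero_neq_one)

lemma Var_dvd_multD:
  assumes "Var i dvd (p * q :: 'k::field poly3)" "\<not> Var i dvd p"
  shows "Var i dvd q"
  using assms by (simp add: Var_dvd_iff)

lemma not_Var_dvd_Var: "i \<noteq> j \<Longrightarrow> \<not> Var i dvd (Var j :: 'k::field poly3)"
  by (simp add: Var_dvd_iff)

lemma Var_dvd_cancel_Var:
  "Var i * p = Var j * q \<Longrightarrow> i \<noteq> j \<Longrightarrow> Var i dvd (q :: 'k::field poly3)"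
  by (metis Var_dvd_multD not_Var_dvd_Var dvd_triv_left)

lemma Var_power_dvd_cancel:
  assumes "Var i ^ n dvd (Var j ^ k * q :: 'k::field poly3)" "i \<noteq> j"
  shows "Var i ^ n dvd q"
  using assms(1)
proof (induction n arbitrary: q)
  case (Suc n)
  from Suc.prems have "Var i dvd Var j ^ k * q"
    by (metis dvd_def dvd_mult_left power_Suc)
  moreover have "\<not> Var i dvd (Var j ^ k :: 'k poly3)"
    using assms(2) by (simp add: Var_dvd_iff)
  ultimately obtain q' where q': "q = Var i * q'"
    using Var_dvd_multD by blast
  from Suc.prems have "Var i * Var i ^ n dvd Var i * (Var j ^ k * q')"
    by (simp add: q' algebra_simps)
  then have "Var i ^ n dvd Var j ^ k * q'"
    using dvd_mult_cancel_left[of "Var i"] Var_neq_0 by blast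
  then have "Var i ^ n dvd q'" by (rule Suc.IH)
  then show ?case unfolding q' power_Suc by (intro mult_dvd_mono dvd_refl)
qed simp

section \<open>Unique factorisation\<close>

text \<open>
  A field is isomorphic to its field of fractions. The field operations give the fractions a greatest
  common divisor, so polynomial rings over them are factorial rings in the sense of the type classes,
  whatever the field is; the polynomials in three variables inherit unique factorisation from there.
\<close>

instantiation fract :: (idom)
  "{unique_euclidean_ring, normalization_euclidean_semiring, normalization_semidom_multiplicative}"
begin

definition [simp]: "normalize_fract = (normalize_field :: 'a fract \<Rightarrow> _)"
definition [simp]: "unit_factor_fract = (unit_factor_field :: 'a fract \<Rightarrow> _)"
definition [simp]: "modulo_fract = (mod_field :: 'a fract \<Rightarrow> _)"
definition [simp]: "euclidean_size_fract = (euclidean_size_field :: 'a fract \<Rightarrow> _)"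
definition [simp]: "division_segment (x :: 'a fract) = 1"

instance
  by standard (simp_all add: dvd_field_iff field_split_simps split: if_splits)

end

instantiation fract :: (idom) euclidean_ring_gcd
begin

definition gcd_fract :: "'a fract \<Rightarrow> 'a fract \<Rightarrow> 'a fract" where
  "gcd_fract = Euclidean_Algorithm.gcd"
definition lcm_fract :: "'a fract \<Rightarrow> 'a fract \<Rightarrow> 'a fract" where
  "lcm_fract = Euclidean_Algorithm.lcm"
definition Gcd_fract :: "'a fract set \<Rightarrow> 'a fract" where
  "Gcd_fract = Euclidean_Algorithm.Gcd"
definition Lcm_fract :: "'a fract set \<Rightarrow> 'a fract" where
  "Lcm_fract = Euclidean_Algorithm.Lcm"

instance
  by standard (simp_all add: gcd_fract_def lcm_fract_def Gcd_fract_def Lcm_fract_def)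

end

instance fract :: (idom) field_gcd ..

text \<open>
  The polynomial seen in \<open>A[x\<^sub>2][x\<^sub>1][x\<^sub>0]\<close>, with coefficients transported along \<open>j\<close>. The first
  variable is the outermost one: it is the one that gets eliminated below.
\<close>

definition nest :: "('a::comm_ring_1 \<Rightarrow> 'b::comm_ring_1) \<Rightarrow> 'a poly3 \<Rightarrow> 'b poly poly poly"
  where "nest j = eval3 (\<lambda>c. [:[:[:j c:]:]:])
    (\<lambda>i. if i = 0 then [:0, 1:] else if i = 1 then [:[:0, 1:]:] else [:[:[:0, 1:]:]:])"

lemma ring_morphism_const_poly: "ring_morphism j \<Longrightarrow> ring_morphism (\<lambda>c. [:j c:])"
  by (simp add: ring_morphism_def one_pCons)

lemma ring_morphism_nest: "ring_morphism j \<Longrightarrow> ring_morphism (nest j)"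
  unfolding nest_def by (intro ring_morphism_eval3 ring_morphism_const_poly)

lemma nest_single:
  assumes "ring_morphism j"
  shows "nest j (Poly_Mapping.single m c) = monom (monom (monom (j c) (expo m 2)) (expo m 1)) (expo m 0)"
proof -
  have "nest j (Poly_Mapping.single m c) = [:[:[:j c:]:]:]
      * ([:0, 1:] ^ expo m 0 * [:[:0, 1:]:] ^ expo m 1 * [:[:[:0, 1:]:]:] ^ expo m 2)"
    unfolding nest_def using assms
    by (simp add: eval3_single ring_morphism.zero prod_UNIV_3)
  also have "\<dots> = monom (monom (monom (j c) (expo m 2)) (expo m 1)) (expo m 0)"
    by (simp add: poly_const_pow monom_altdef smult_monom mult.commute mult.left_commute)
  finally show ?thesis .
qed

lemma coeff_nest:
  assumes "ring_morphism j"
  shows "coeff (coeff (coeff (nest j p) (expo m 0)) (expo m 1)) (expo m 2) = j (coeff3 p m)"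
proof (induction p rule: monomial_induct)
  case (monomial n c)
  have "n = m \<longleftrightarrow> expo n 0 = expo m 0 \<and> expo n 1 = expo m 1 \<and> expo n 2 = expo m 2"
    by (auto intro!: poly_mapping_eqI) (metis exhaust_3)
  then show ?case
    using assms by (auto simp: nest_single lookup_single ring_morphism.zero when_def)
qed (simp add: assms ring_morphism.add[OF ring_morphism_nest] ring_morphism.add lookup_add)

lemma nest_eq_0:
  assumes "ring_morphism j" "\<And>c. j c = 0 \<Longrightarrow> c = 0" "nest j p = 0"
  shows "p = 0"
proof (rule poly_mapping_eqI)
  fix m show "coeff3 p m = coeff3 0 m"
    using coeff_nest[OF assms(1), of p m] assms by simp
qed

lemma exists_poly_neq_0:
  assumes "infinite A" "p \<noteq> (0 :: 'a::idom poly)"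
  obtains a where "a \<in> A" "poly p a \<noteq> 0"
proof -
  have "\<not> A \<subseteq> {a. poly p a = 0}"
    using assms poly_roots_finite finite_subset by blast
  then show thesis using that by blast
qed

lemma exists_eval3_neq_0:
  assumes "infinite (UNIV :: 'k::field set)" "p \<noteq> (0 :: 'k poly3)"
  obtains a where "eval3 (\<lambda>x. x) a p \<noteq> 0"
proof -
  have id: "ring_morphism (\<lambda>x :: 'k. x)" by (simp add: ring_morphism_def)
  have inf: "infinite (range (\<lambda>x :: 'k. [:[:x:]:]))" "infinite (range (\<lambda>x :: 'k. [:x:]))"
    using assms(1) by (auto simp: finite_image_iff inj_on_def)
  have "nest (\<lambda>x. x) p \<noteq> 0"
    using nest_eq_0[OF id] assms by blast
  from exists_poly_neq_0[OF inf(1) this] obtain x where "poly (nest (\<lambda>x. x) p) [:[:x:]:] \<noteq> 0"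
    by auto
  from exists_poly_neq_0[OF inf(2) this] obtain y
    where "poly (poly (nest (\<lambda>x. x) p) [:[:x:]:]) [:y:] \<noteq> 0"
    by auto
  from exists_poly_neq_0[OF assms(1) this] obtain z
    where xyz: "poly (poly (poly (nest (\<lambda>x. x) p) [:[:x:]:]) [:y:]) z \<noteq> 0"
    by auto
  have "poly (poly (poly (nest (\<lambda>x. x) p) [:[:x:]:]) [:y:]) z
      = eval3 (\<lambda>x. x) (\<lambda>i. if i = 0 then x else if i = 1 then y else z) p"
  proof (rule ring_morphism_eqI[where \<phi> = "\<lambda>p. poly (poly (poly (nest (\<lambda>x. x) p) [:[:x:]:]) [:y:]) z"])
    show "ring_morphism (\<lambda>p. poly (poly (poly (nest (\<lambda>x. x) p) [:[:x:]:]) [:y:]) z)"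
      using ring_morphism_nest[OF id] by (simp add: ring_morphism_def)
    show "ring_morphism (eval3 (\<lambda>x. x) (\<lambda>i. if i = 0 then x else if i = 1 then y else z))"
      by (rule ring_morphism_eval3[OF id])
  next
    fix c show "poly (poly (poly (nest (\<lambda>x. x) (Const c)) [:[:x:]:]) [:y:]) z
        = eval3 (\<lambda>x. x) (\<lambda>i. if i = 0 then x else if i = 1 then y else z) (Const c)"
      using id by (simp add: nest_def ring_morphism_const_poly)
  next
    fix i show "poly (poly (poly (nest (\<lambda>x. x) (Var i)) [:[:x:]:]) [:y:]) z
        = eval3 (\<lambda>x. x) (\<lambda>i. if i = 0 then x else if i = 1 then y else z) (Var i)"
      using id by (simp add: nest_def ring_morphism_const_poly)
  qed
  with xyz show thesis using that by metis
qed

text \<open>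
  Over a finite field, adding \<open>1\<close> to the product of all \<open>X - a\<close> gives a polynomial without roots.
\<close>

lemma infinite_alg_closed_field: "infinite (UNIV :: 'k::alg_closed_field set)"
proof
  assume fin: "finite (UNIV :: 'k set)"
  let ?p = "(\<Prod>a\<in>(UNIV :: 'k set). [:- a, 1:]) :: 'k poly"
  have "degree ?p = card (UNIV :: 'k set)"
    by (subst degree_prod_eq_sum_degree) auto
  then have "degree (?p + 1) > 0"
    using fin by (simp add: degree_add_eq_left card_gt_0_iff)
  then obtain x where "poly (?p + 1) x = 0"
    using alg_closed_imp_poly_has_root by blast
  moreover have "poly ?p x = 0"
    using fin by (auto simp: poly_prod)
  ultimately show False by simp
qed

abbreviation fnest :: "'k::field poly3 \<Rightarrow> 'k fract poly poly poly"
  where "fnest \<equiv> nest to_fract"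

lemma ring_morphism_to_fract: "ring_morphism (to_fract :: 'a::idom \<Rightarrow> _)"
  by (simp add: ring_morphism_def)

interpretation fnest: ring_morphism "fnest :: 'k::field poly3 \<Rightarrow> _"
  by (rule ring_morphism_nest[OF ring_morphism_to_fract])

lemma fnest_inj: "fnest p = fnest q \<longleftrightarrow> p = (q :: 'k::field poly3)"
proof
  assume "fnest p = fnest q"
  then have "fnest (p - q) = 0" by simp
  then have "p - q = 0"
    by (rule nest_eq_0[OF ring_morphism_to_fract, rotated]) simp
  then show "p = q" by simp
qed simp

lemma fnest_surj: "surj (fnest :: 'k::field poly3 \<Rightarrow> _)"
proof -
  let ?R = "range (fnest :: 'k poly3 \<Rightarrow> _)"
  have add: "a + b \<in> ?R" if "a \<in> ?R" "b \<in> ?R" for a b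
    using that by (auto simp flip: fnest.add)
  have mult: "a * b \<in> ?R" if "a \<in> ?R" "b \<in> ?R" for a b
    using that by (auto simp flip: fnest.mult)
  have "fnest (Var 0) = [:0, 1:]" "fnest (Var 1) = [:[:0, 1:]:]" "fnest (Var 2) = [:[:[:0, 1:]:]:]"
    by (simp_all add: nest_def ring_morphism_const_poly ring_morphism_to_fract)
  then have vars: "[:0, 1:] \<in> ?R" "[:[:0, 1:]:] \<in> ?R" "[:[:[:0, 1:]:]:] \<in> ?R"
    by (metis rangeI)+
  have c0: "[:[:[:c:]:]:] \<in> ?R" for c
  proof (cases c)
    case (Fract a b)
    then have "c = to_fract (a / b)"
      by (simp add: Fract_conv_to_fract[symmetric] to_fract_def eq_fract)
    then have "[:[:[:c:]:]:] = fnest (Const (a / b))"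
      by (simp add: nest_def ring_morphism_const_poly ring_morphism_to_fract)
    then show ?thesis by simp
  qed
  have c1: "[:[:q:]:] \<in> ?R" for q
  proof (induction q)
    case 0
    show ?case using c0[of 0] by simp
  next
    case (pCons a q)
    have "[:[:pCons a q:]:] = [:[:[:a:]:]:] + [:[:[:0, 1:]:]:] * [:[:q:]:]" by simp
    then show ?case using pCons c0[of a] vars add mult by metis
  qed
  have c2: "[:q:] \<in> ?R" for q
  proof (induction q)
    case 0
    show ?case using c1[of 0] by simp
  next
    case (pCons a q)
    have "[:pCons a q:] = [:[:a:]:] + [:[:0, 1:]:] * [:q:]" by simp
    then show ?case using pCons c1[of a] vars add mult by metis
  qed
  have "q \<in> ?R" for q
  proof (induction q)
    case 0
    show ?case using c2[of 0] by simp
  next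
    case (pCons a q)
    have "pCons a q = [:a:] + [:0, 1:] * q" by simp
    then show ?case using pCons c2[of a] vars add mult by metis
  qed
  then show ?thesis by blast
qed

lemma fnest_dvd_iff: "fnest p dvd fnest q \<longleftrightarrow> p dvd (q :: 'k::field poly3)"
proof
  assume "fnest p dvd fnest q"
  then obtain s where "fnest q = fnest p * s" by (elim dvdE)
  moreover obtain r where "s = fnest r" using fnest_surj by (meson surjE)
  ultimately have "q = p * r" by (simp flip: fnest.mult add: fnest_inj)
  then show "p dvd q" by simp
qed (rule fnest.dvd)

text \<open>
  A prime that divides the \<open>n\<close>-th powers of three elements divides the elements, so removing the
  greatest common divisor makes all these powers coprime at once. The second property of the triple
  expresses this in the form in which it is used: \<open>D\<close> divides the ideal generated by the
  \<open>g'\<^sub>i\<^sup>n q\<close>, hence \<open>q\<close>.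
\<close>

lemma gcd_split:
  fixes g :: "3 \<Rightarrow> 'a::{factorial_ring_gcd, semiring_gcd_mult_normalize}"
  assumes nz: "\<exists>i. g i \<noteq> 0"
  obtains c g' where "\<And>i. g i = c * g' i"
    "\<And>D q n. (\<And>i. D dvd g' i ^ n * q) \<Longrightarrow> D dvd q"
proof -
  define c where "c = gcd (g 0) (gcd (g 1) (g 2))"
  have "c dvd g i" for i
    using exhaust_3[of i] unfolding c_def by (metis dvd_trans gcd_dvd1 gcd_dvd2)
  then have "\<forall>i. \<exists>r. g i = c * r" by (auto elim: dvdE)
  then have "\<exists>g'. \<forall>i. g i = c * g' i" by (rule choice)
  then obtain g' where g': "\<And>i. g i = c * g' i" by blast
  have "c \<noteq> 0" using nz g' by auto
  have coprime: "x dvd 1" if "\<And>i. x dvd g' i" for x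
  proof -
    have "c * x dvd g i" for i
      unfolding g' using that[of i] by (rule mult_dvd_mono[OF dvd_refl])
    then have "c * x dvd c" unfolding c_def by (intro gcd_greatest) auto
    then have "c * x dvd c * 1" by simp
    then show ?thesis using \<open>c \<noteq> 0\<close> by (simp only: dvd_mult_cancel_left) simp
  qed
  have "D dvd q" if D: "\<And>i. D dvd g' i ^ n * q" for D q n
  proof -
    have scale: "gcd (a * q) (b * q) dvd gcd a b * q" for a b :: 'a
      by (simp add: gcd_mult_right)
    have "D dvd gcd (g' 1 ^ n * q) (g' 2 ^ n * q)"
      by (intro gcd_greatest D)
    then have "D dvd gcd (g' 1 ^ n) (g' 2 ^ n) * q"
      using scale by (rule dvd_trans)
    with D[of 0] have "D dvd gcd (g' 0 ^ n * q) (gcd (g' 1 ^ n) (g' 2 ^ n) * q)"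
      by (rule gcd_greatest)
    then have "D dvd gcd (g' 0 ^ n) (gcd (g' 1 ^ n) (g' 2 ^ n)) * q"
      using scale by (rule dvd_trans)
    then have "D dvd gcd (g' 0) (gcd (g' 1) (g' 2)) ^ n * q"
      by simp
    moreover have "gcd (g' 0) (gcd (g' 1) (g' 2)) dvd g' i" for i
      using exhaust_3[of i] by (metis dvd_trans gcd_dvd1 gcd_dvd2)
    then have "is_unit (gcd (g' 0) (gcd (g' 1) (g' 2)) ^ n)"
      using coprime is_unit_power_iff by blast
    ultimately show ?thesis
      by (simp add: dvd_mult_unit_iff')
  qed
  with g' show thesis using that by blast
qed

lemma common_factor_split:
  fixes g :: "3 \<Rightarrow> 'k::field poly3"
  assumes "\<exists>i. g i \<noteq> 0"
  obtains c g' where "\<And>i. g i = c * g' i"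
    "\<And>D q n. (\<And>i. D dvd g' i ^ n * q) \<Longrightarrow> D dvd q"
proof -
  have nz: "\<exists>i. fnest (g i) \<noteq> 0" using assms fnest_inj[of _ 0] by (metis fnest.zero)
  obtain c g' where g': "\<And>i. fnest (g i) = c * g' i"
    and dvd: "\<And>D q n. (\<And>i. D dvd g' i ^ n * q) \<Longrightarrow> D dvd q"
    using gcd_split[OF nz] by blast
  obtain b where b: "c = fnest b" using fnest_surj by (meson surjE)
  have "\<forall>i. \<exists>a. g' i = fnest a" using fnest_surj unfolding surj_def by blast
  then have "\<exists>a. \<forall>i. g' i = fnest (a i)" by (rule choice)
  then obtain a where a: "\<And>i. g' i = fnest (a i)" by blast
  show thesis
  proof (rule that[of b a])
    show "g i = b * a i" for i
      using g'[of i] unfolding a b fnest.mult[symmetric] fnest_inj .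
    show "D dvd q" if D: "\<And>i. D dvd a i ^ n * q" for D q n
    proof -
      have "fnest D dvd g' i ^ n * fnest q" for i
        unfolding a fnest.power[symmetric] fnest.mult[symmetric] fnest_dvd_iff by (rule D)
      then have "fnest D dvd fnest q" by (rule dvd)
      then show ?thesis unfolding fnest_dvd_iff .
    qed
  qed
qed

text \<open>
  A nonzero element of least degree in the ideal leaves no remainder under pseudo-division, so by
  Gauss's lemma its primitive part divides all \<open>f\<^sub>i\<close>. Coprimality makes this primitive part a unit,
  and the element a constant.
\<close>

lemma elimination:
  fixes f :: "3 \<Rightarrow> 'a::{factorial_ring_gcd, semiring_gcd_mult_normalize} poly"
  assumes "\<exists>i. f i \<noteq> 0" and coprime: "\<And>h. (\<And>i. h dvd f i) \<Longrightarrow> h dvd 1"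
  obtains \<alpha> r where "(\<Sum>i\<in>UNIV. \<alpha> i * f i) = [:r:]" "r \<noteq> 0"
proof -
  define I where "I = {p. \<exists>\<alpha>. p = (\<Sum>i\<in>UNIV. \<alpha> i * f i)}"
  have fI: "f i \<in> I" for i
    unfolding I_def using exhaust_3[of i]
    by (intro CollectI exI[of _ "\<lambda>j. if j = i then 1 else 0"]) (auto simp: sum_UNIV_3)
  have multI: "q * p \<in> I" if p: "p \<in> I" for p q
  proof -
    from p obtain \<alpha> where "p = (\<Sum>i\<in>UNIV. \<alpha> i * f i)" unfolding I_def by blast
    then have "q * p = (\<Sum>i\<in>UNIV. (q * \<alpha> i) * f i)" by (simp add: sum_distrib_left mult.assoc)
    then show ?thesis unfolding I_def by (intro CollectI exI[of _ "\<lambda>i. q * \<alpha> i"])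
  qed
  have diffI: "p - q \<in> I" if pq: "p \<in> I" "q \<in> I" for p q
  proof -
    from pq obtain \<alpha> \<beta> where "p = (\<Sum>i\<in>UNIV. \<alpha> i * f i)" "q = (\<Sum>i\<in>UNIV. \<beta> i * f i)"
      unfolding I_def by blast
    then have "p - q = (\<Sum>i\<in>UNIV. (\<alpha> i - \<beta> i) * f i)"
      by (simp only: sum_subtractf left_diff_distrib)
    then show ?thesis unfolding I_def by (intro CollectI exI[of _ "\<lambda>i. \<alpha> i - \<beta> i"])
  qed
  have "\<exists>p. p \<in> I \<and> p \<noteq> 0" using assms(1) fI by blast
  from exists_least_iff[THEN iffD1, of "\<lambda>n. \<exists>p. p \<in> I \<and> p \<noteq> 0 \<and> degree p = n"] this
  obtain p where p: "p \<in> I" "p \<noteq> 0" and least: "\<And>q. q \<in> I \<Longrightarrow> q \<noteq> 0 \<Longrightarrow> degree p \<le> degree q"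
    by (metis not_less)
  define p' where "p' = primitive_part p"
  have p': "p = smult (content p) p'" by (simp add: p'_def)
  have "p' dvd f i" for i
  proof -
    obtain a q where a: "a \<noteq> 0" "smult a (f i) = p * q + pseudo_mod (f i) p"
      using pseudo_mod(1)[OF p(2)] by blast
    have "pseudo_mod (f i) p = [:a:] * f i - q * p"
      using a(2) by (simp add: mult.commute)
    then have "pseudo_mod (f i) p \<in> I"
      using diffI multI fI p(1) by metis
    then have "pseudo_mod (f i) p = 0"
      using least pseudo_mod(2)[OF p(2)] by (meson not_less)
    then have "smult a (f i) = p' * (smult (content p) q)"
      using a(2) p' by (metis add.right_neutral mult_smult_left mult_smult_right)
    then have "fract_poly (smult a (f i)) = fract_poly (p' * smult (content p) q)" by simp
    then have "smult (to_fract a) (fract_poly (f i)) = fract_poly p' * fract_poly (smult (content p) q)"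
      by simp
    then have "fract_poly p' dvd smult (to_fract a) (fract_poly (f i))" by (metis dvd_triv_left)
    then have "fract_poly p' dvd fract_poly (f i)"
      using a(1) by (simp add: dvd_smult_iff)
    moreover have "content p' = 1" using p(2) by (simp add: p'_def)
    ultimately show ?thesis by (rule fract_poly_dvdD)
  qed
  then have "p' dvd 1" by (rule coprime)
  then have "degree p' = 0" by (auto simp: is_unit_poly_iff)
  then have "degree p = 0" by (simp add: p'_def)
  then obtain r where "p = [:r:]" by (rule degree_eq_zeroE)
  moreover obtain \<alpha> where "p = (\<Sum>i\<in>UNIV. \<alpha> i * f i)" using p(1) unfolding I_def by blast
  ultimately show thesis using that[of \<alpha> r] p(2) by (metis pCons_0_0)
qed

lemma no_fixed_part_elimination:
  fixes f :: "3 \<Rightarrow> 'k::field poly3"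
  assumes "no_fixed_part f" "\<exists>i. f i \<noteq> 0"
  obtains \<alpha> r where "(\<Sum>i\<in>UNIV. \<alpha> i * f i) = r" "r \<noteq> 0" "\<And>m. coeff3 r m \<noteq> 0 \<Longrightarrow> expo m 0 = 0"
proof -
  have nz: "\<exists>i. fnest (f i) \<noteq> 0" using assms(2) fnest_inj[of _ 0] by (metis fnest.zero)
  have coprime: "h dvd 1" if h: "\<And>i. h dvd fnest (f i)" for h
  proof -
    obtain h' where h': "h = fnest h'" using fnest_surj by (meson surjE)
    then have "h' dvd 1"
      using h assms(1) by (simp add: no_fixed_part_def fnest_dvd_iff)
    then show ?thesis using fnest.dvd[of h' 1] h' by simp
  qed
  from elimination[OF nz coprime] obtain \<beta> s
    where s: "(\<Sum>i\<in>UNIV. \<beta> i * fnest (f i)) = [:s:]" "s \<noteq> 0"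
    by blast
  have "\<forall>i. \<exists>a. \<beta> i = fnest a" using fnest_surj unfolding surj_def by blast
  then have "\<exists>\<alpha>. \<forall>i. \<beta> i = fnest (\<alpha> i)" by (rule choice)
  then obtain \<alpha> where \<alpha>: "\<And>i. \<beta> i = fnest (\<alpha> i)" by blast
  define r where "r = (\<Sum>i\<in>UNIV. \<alpha> i * f i)"
  have r: "fnest r = [:s:]" using s(1) by (simp add: r_def \<alpha>)
  have "r \<noteq> 0" using r s(2) by auto
  moreover have "expo m 0 = 0" if "coeff3 r m \<noteq> 0" for m
  proof (rule ccontr)
    assume "expo m 0 \<noteq> 0"
    then have "coeff [:s:] (expo m 0) = 0" by (simp add: coeff_pCons split: nat.splits)
    then show False using coeff_nest[OF ring_morphism_to_fract, of r m] r that by simp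
  qed
  ultimately show thesis using that r_def by blast
qed

section \<open>Ideals generated by three forms\<close>

text \<open>
Gaussian elimination of one unknown per equation.
\<close>

lemma underdetermined_system:
  fixes c :: "'e \<Rightarrow> 'j \<Rightarrow> 'k::field"
  assumes "finite E" "finite J" "card E < card J"
  shows "\<exists>a. (\<exists>j\<in>J. a j \<noteq> 0) \<and> (\<forall>e\<in>E. (\<Sum>j\<in>J. c e j * a j) = 0)"
  using assms
proof (induction E arbitrary: J c rule: finite_induct)
  case empty
  then obtain j where "j \<in> J" by fastforce
  then show ?case by (intro exI[of _ "\<lambda>_. 1"]) auto
next
  case (insert e E)
  show ?case
  proof (cases "\<forall>j\<in>J. c e j = 0")
    case True
    have "card E < card J" using insert by simp
    from insert.IH[OF insert.prems(1) this, of c] True show ?thesis by auto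
  next
    case False
    then obtain j0 where j0: "j0 \<in> J" "c e j0 \<noteq> 0" by blast
    define J' where "J' = J - {j0}"
    define c' where "c' = (\<lambda>i j. c i j - c i j0 * c e j / c e j0)"
    have J: "J = insert j0 J'" "j0 \<notin> J'" "finite J'"
      using j0 insert.prems by (auto simp: J'_def)
    have "card E < card J'"
      using insert J by simp
    from insert.IH[OF J(3) this, of c'] obtain a where a: "\<exists>j\<in>J'. a j \<noteq> 0"
      "\<And>i. i \<in> E \<Longrightarrow> (\<Sum>j\<in>J'. c' i j * a j) = 0" by blast
    define s where "s = (\<Sum>j\<in>J'. c e j * a j) / c e j0"
    define b where "b = a(j0 := - s)"
    have sum_b: "(\<Sum>j\<in>J. c i j * b j) = (\<Sum>j\<in>J'. c i j * a j) - c i j0 * s" for i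
    proof -
      have "(\<Sum>j\<in>J'. c i j * b j) = (\<Sum>j\<in>J'. c i j * a j)"
        by (rule sum.cong) (use J in \<open>auto simp: b_def\<close>)
      then show ?thesis using J by (simp add: b_def)
    qed
    have "(\<Sum>j\<in>J. c i j * b j) = 0" if "i \<in> insert e E" for i
    proof (cases "i = e")
      case True
      then show ?thesis using j0 by (simp add: sum_b s_def)
    next
      case False
      have "(\<Sum>j\<in>J'. c' i j * a j) = (\<Sum>j\<in>J'. c i j * a j) - c i j0 * s"
        by (simp add: c'_def s_def left_diff_distrib sum_subtractf sum_distrib_left sum_divide_distrib
            algebra_simps)
      then show ?thesis using False that a(2)[of i] by (simp add: sum_b)
    qed
    moreover have "\<exists>j\<in>J. b j \<noteq> 0" using a(1) J by (auto simp: b_def)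
    ultimately show ?thesis by blast
  qed
qed

lemma dependent_family:
  fixes v :: "'j::finite \<Rightarrow> 'k::field poly3"
  assumes "finite E" "\<And>j. Poly_Mapping.keys (v j) \<subseteq> E" "card E < CARD('j)"
  obtains a j where "a j \<noteq> 0" "(\<Sum>j\<in>UNIV. Const (a j) * v j) = 0"
proof -
  obtain a where a: "\<exists>j\<in>UNIV. a j \<noteq> 0" "\<forall>m\<in>E. (\<Sum>j\<in>UNIV. coeff3 (v j) m * a j) = 0"
    using underdetermined_system[OF assms(1) finite_class.finite_UNIV assms(3), of "\<lambda>m j. coeff3 (v j) m"]
    by blast
  have "(\<Sum>j\<in>UNIV. Const (a j) * v j) = 0"
  proof (rule poly_mapping_eqI)
    fix m
    have "(\<Sum>j\<in>UNIV. a j * coeff3 (v j) m) = 0"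
    proof (cases "m \<in> E")
      case True
      then show ?thesis using a(2) by (simp add: mult.commute)
    next
      case False
      then have "coeff3 (v j) m = 0" for j using assms(2)[of j] by (auto simp: in_keys_iff)
      then show ?thesis by simp
    qed
    then show "coeff3 (\<Sum>j\<in>UNIV. Const (a j) * v j) m = coeff3 0 m"
      by (simp add: lookup_sum)
  qed
  with a(1) that show thesis by blast
qed

definition is_ideal :: "'a::comm_ring_1 set \<Rightarrow> bool"
  where "is_ideal X \<longleftrightarrow> 0 \<in> X \<and> (\<forall>a\<in>X. \<forall>b\<in>X. a + b \<in> X) \<and> (\<forall>a\<in>X. \<forall>r. r * a \<in> X)"

lemma is_ideal_0: "is_ideal X \<Longrightarrow> 0 \<in> X"
  and is_ideal_add: "is_ideal X \<Longrightarrow> a \<in> X \<Longrightarrow> b \<in> X \<Longrightarrow> a + b \<in> X"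
  and is_ideal_mult: "is_ideal X \<Longrightarrow> a \<in> X \<Longrightarrow> r * a \<in> X"
  by (auto simp: is_ideal_def)

lemma is_ideal_mult': "is_ideal X \<Longrightarrow> a \<in> X \<Longrightarrow> a * r \<in> X"
  using is_ideal_mult[of X a r] by (simp add: mult.commute)

lemma is_ideal_uminus: "is_ideal X \<Longrightarrow> a \<in> X \<Longrightarrow> - a \<in> X"
  using is_ideal_mult[of X a "- 1"] by simp

lemma is_ideal_diff: "is_ideal X \<Longrightarrow> a \<in> X \<Longrightarrow> b \<in> X \<Longrightarrow> a - b \<in> X"
  using is_ideal_add[of X a "- b"] is_ideal_uminus[of X b] by simp

lemma is_ideal_sum: "is_ideal X \<Longrightarrow> (\<And>i. i \<in> A \<Longrightarrow> f i \<in> X) \<Longrightarrow> (\<Sum>i\<in>A. f i) \<in> X"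
  by (induction A rule: infinite_finite_induct) (auto intro: is_ideal_0 is_ideal_add)

lemma is_ideal_colon: "is_ideal X \<Longrightarrow> is_ideal {p. p * h \<in> X}"
  by (auto simp: is_ideal_def distrib_right mult.assoc)

lemma is_ideal_power_mono:
  assumes "is_ideal X" "x ^ m * h \<in> X" "m \<le> n"
  shows "x ^ n * h \<in> X"
proof -
  have "x ^ n * h = x ^ (n - m) * (x ^ m * h)"
    using assms(3) by (simp add: mult.assoc[symmetric] power_add[symmetric])
  then show ?thesis using assms is_ideal_mult by metis
qed

lemma module_mult: "module ((*) :: 'a::comm_ring_1 \<Rightarrow> 'a \<Rightarrow> 'a)"
  by unfold_locales (simp_all add: algebra_simps)

lemma is_ideal_ideal_generated: "is_ideal (ideal_generated S)"
  unfolding is_ideal_def ideal_generated_def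
  by (auto intro: module.span_zero[OF module_mult] module.span_add[OF module_mult]
      module.span_scale[OF module_mult])

lemma ideal_generated_superset: "a \<in> S \<Longrightarrow> a \<in> ideal_generated S"
  unfolding ideal_generated_def by (rule module.span_base[OF module_mult])

lemma ideal_generated_least:
  assumes "a \<in> ideal_generated S" "is_ideal X" "S \<subseteq> X"
  shows "a \<in> X"
  using assms(1) unfolding ideal_generated_def
proof (rule module.span_induct[OF module_mult])
  show "module.subspace (*) {a. a \<in> X}"
    using assms(2) by (simp add: module.subspace_def[OF module_mult] is_ideal_def)
qed (use assms(3) in auto)

lemma is_ideal_base_ideal: "is_ideal (base_ideal f)"
  unfolding base_ideal_def by (rule is_ideal_ideal_generated)

lemma base_ideal_gen: "f i \<in> base_ideal f"
  unfolding base_ideal_def by (rule ideal_generated_superset) simp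

lemma base_idealI: "(\<Sum>i\<in>UNIV. a i * f i) \<in> base_ideal f"
  by (intro is_ideal_sum is_ideal_mult is_ideal_base_ideal base_ideal_gen)

lemma base_idealE:
  assumes "p \<in> base_ideal f"
  obtains a where "p = (\<Sum>i\<in>UNIV. a i * f i)"
proof -
  let ?X = "{p. \<exists>a. p = (\<Sum>i\<in>UNIV. a i * f i)}"
  have "is_ideal ?X"
    unfolding is_ideal_def
  proof (intro conjI ballI allI)
    show "0 \<in> ?X" by (intro CollectI exI[of _ "\<lambda>_. 0"]) simp
  next
    fix p q assume "p \<in> ?X" "q \<in> ?X"
    then obtain a b where "p = (\<Sum>i\<in>UNIV. a i * f i)" "q = (\<Sum>i\<in>UNIV. b i * f i)" by blast
    then have "p + q = (\<Sum>i\<in>UNIV. (a i + b i) * f i)"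
      by (simp only: distrib_right sum.distrib)
    then show "p + q \<in> ?X" by (intro CollectI exI[of _ "\<lambda>i. a i + b i"])
  next
    fix p r assume "p \<in> ?X"
    then obtain a where "p = (\<Sum>i\<in>UNIV. a i * f i)" by blast
    then have "r * p = (\<Sum>i\<in>UNIV. (r * a i) * f i)"
      by (simp only: sum_distrib_left mult.assoc)
    then show "r * p \<in> ?X" by (intro CollectI exI[of _ "\<lambda>i. r * a i"])
  qed
  moreover have "range f \<subseteq> ?X"
  proof safe
    fix i
    have "f i = (\<Sum>j\<in>UNIV. (if j = i then 1 else 0) * f j)"
      using exhaust_3[of i] by (auto simp: sum_UNIV_3)
    then show "\<exists>a. f i = (\<Sum>j\<in>UNIV. a j * f j)" by (rule exI[of _ "\<lambda>j. if j = i then 1 else 0"])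
  qed
  ultimately have "p \<in> ?X"
    using assms ideal_generated_least unfolding base_ideal_def by blast
  then show thesis using that by blast
qed

lemma base_ideal_least: "is_ideal X \<Longrightarrow> (\<And>i. f i \<in> X) \<Longrightarrow> base_ideal f \<subseteq> X"
  using ideal_generated_least unfolding base_ideal_def by (metis image_subset_iff subsetI)

lemma base_ideal_subst3:
  assumes "p \<in> base_ideal f"
  shows "subst3 A p \<in> base_ideal (\<lambda>i. subst3 A (f i))"
proof -
  from assms obtain a where "p = (\<Sum>i\<in>UNIV. a i * f i)" by (rule base_idealE)
  then have "subst3 A p = (\<Sum>i\<in>UNIV. subst3 A (a i) * subst3 A (f i))" by simp
  then show ?thesis
    using base_idealI[of "\<lambda>i. subst3 A (a i)" "\<lambda>i. subst3 A (f i)"] by simp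
qed

lemma form_part_base_ideal:
  assumes "\<And>i. is_form d (f i)" "p \<in> base_ideal f"
  shows "form_part n p \<in> base_ideal f"
proof -
  from assms(2) obtain a where a: "p = (\<Sum>i\<in>UNIV. a i * f i)" by (rule base_idealE)
  have "form_part n (q * f i) \<in> base_ideal f" for q i
  proof (cases "n < d")
    case True
    then show ?thesis
      using form_part_mult_less[OF assms(1)] is_ideal_0[OF is_ideal_base_ideal] by metis
  next
    case False
    then have "form_part n (q * f i) = form_part (n - d) q * f i"
      using form_part_mult[OF assms(1), of "n - d"] by simp
    then show ?thesis
      by (simp add: is_ideal_mult is_ideal_base_ideal base_ideal_gen)
  qed
  then show ?thesis
    unfolding a form_part_sum by (intro is_ideal_sum is_ideal_base_ideal)
qed

lemma form_in_base_ideal: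
  assumes "\<And>i. is_form d (f i)" "is_form (n + d) p" "p \<in> base_ideal f"
  obtains a where "\<And>i. is_form n (a i)" "p = (\<Sum>i\<in>UNIV. a i * f i)"
proof -
  from assms(3) obtain a where a: "p = (\<Sum>i\<in>UNIV. a i * f i)" by (rule base_idealE)
  have "p = form_part (n + d) p" using assms(2) by (simp add: form_part_form)
  also have "\<dots> = (\<Sum>i\<in>UNIV. form_part n (a i) * f i)"
    unfolding a form_part_sum using assms(1) by (simp add: form_part_mult)
  finally show thesis using that[of "\<lambda>i. form_part n (a i)"] by simp
qed

lemma form_in_base_ideal_0:
  assumes "\<And>i. is_form d (f i)" "is_form d p" "p \<in> base_ideal f"
  obtains c where "p = (\<Sum>i\<in>UNIV. Const (c i) * f i)"
proof -
  obtain a where a: "\<And>i. is_form 0 (a i)" "p = (\<Sum>i\<in>UNIV. a i * f i)"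
    using form_in_base_ideal[of d f 0 p] assms by auto
  have "p = (\<Sum>i\<in>UNIV. Const (coeff3 (a i) 0) * f i)"
    unfolding a(2) using is_form_0_Const[OF a(1)] by simp
  then show thesis by (rule that)
qed

lemma form_in_base_ideal_less:
  assumes "\<And>i. is_form d (f i)" "is_form n p" "p \<in> base_ideal f" "n < d"
  shows "p = 0"
proof -
  from assms(3) obtain a where a: "p = (\<Sum>i\<in>UNIV. a i * f i)" by (rule base_idealE)
  have "p = form_part n p" using assms(2) by (simp add: form_part_form)
  also have "\<dots> = 0"
    unfolding a form_part_sum by (simp add: form_part_mult_less[OF assms(1,4)])
  finally show ?thesis .
qed

subsection \<open>Membership in the saturation\<close>

text \<open>
  Membership in the saturation. Testing against all forms of some degree, instead of a power of the
  ideal of the variables, makes the notion visibly invariant under linear changes of coordinates.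
\<close>

definition sat_mem :: "(3 \<Rightarrow> 'k::field poly3) \<Rightarrow> 'k poly3 \<Rightarrow> bool"
  where "sat_mem f h \<longleftrightarrow> (\<exists>N. \<forall>p. is_form N p \<longrightarrow> p * h \<in> base_ideal f)"

lemma form_in_ideal:
  assumes "is_ideal X" "is_form N p" "\<And>m. mon_degree m = N \<Longrightarrow> Poly_Mapping.single m 1 \<in> X"
  shows "p \<in> X"
  using assms(2)
  by (rule form_induct) (use assms in \<open>auto intro: is_ideal_0 is_ideal_add is_ideal_mult\<close>)

lemma monomial_in_ideal:
  assumes "is_ideal X" "Var i ^ n \<in> X" "n \<le> expo m i"
  shows "Poly_Mapping.single m 1 \<in> X"
proof -
  have "Var i ^ expo m i \<in> X"
    using is_ideal_power_mono[of X "Var i" n 1 "expo m i"] assms by simp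
  then show ?thesis
    unfolding monomial_eq_prod prod_UNIV_3
    using exhaust_3[of i] assms(1) by (auto intro: is_ideal_mult is_ideal_mult')
qed

text \<open>
  A monomial of degree \<open>n\<^sub>0 + n\<^sub>1 + n\<^sub>2\<close> is divisible by one of the \<open>x\<^sub>i\<close> to the power \<open>n\<^sub>i\<close>.
\<close>

lemma sat_memI_Var_powers:
  assumes "\<And>i. \<exists>n. Var i ^ n * h \<in> base_ideal f"
  shows "sat_mem f h"
proof -
  note I = is_ideal_base_ideal[of f]
  obtain n where n: "\<And>i. Var i ^ n i * h \<in> base_ideal f" using assms by metis
  let ?N = "n 0 + n 1 + n 2"
  have "p * h \<in> base_ideal f" if "is_form ?N p" for p
  proof -
    have "p \<in> {p. p * h \<in> base_ideal f}"
      using is_ideal_colon[OF I] that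
    proof (rule form_in_ideal)
      fix m assume "mon_degree m = ?N"
      then have "n 0 \<le> expo m 0 \<or> n 1 \<le> expo m 1 \<or> n 2 \<le> expo m 2"
        by (auto simp: mon_degree_eq)
      then obtain i where "n i \<le> expo m i" by blast
      with n[of i] show "Poly_Mapping.single m 1 \<in> {p. p * h \<in> base_ideal f}"
        by (intro monomial_in_ideal[OF is_ideal_colon[OF I], of i "n i"]) auto
    qed
    then show ?thesis by simp
  qed
  then show ?thesis unfolding sat_mem_def by blast
qed

lemma sat_mem_mult: "sat_mem f h \<Longrightarrow> sat_mem f (q * h)"
  unfolding sat_mem_def by (metis is_ideal_base_ideal is_ideal_mult mult.left_commute)

lemma sat_mem_base_ideal: "h \<in> base_ideal f \<Longrightarrow> sat_mem f h"
  unfolding sat_mem_def by (metis is_ideal_base_ideal is_ideal_mult)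

lemma sat_mem_diff:
  assumes "sat_mem f g" "sat_mem f h"
  shows "sat_mem f (g - h)"
proof (rule sat_memI_Var_powers)
  fix i
  note I = is_ideal_base_ideal[of f]
  obtain M N where "Var i ^ M * g \<in> base_ideal f" "Var i ^ N * h \<in> base_ideal f"
    using assms is_form_Var_power unfolding sat_mem_def by metis
  then have "Var i ^ (M + N) * g \<in> base_ideal f" "Var i ^ (M + N) * h \<in> base_ideal f"
    by (auto intro: is_ideal_power_mono[OF I])
  then have "Var i ^ (M + N) * (g - h) \<in> base_ideal f"
    unfolding right_diff_distrib by (rule is_ideal_diff[OF I])
  then show "\<exists>n. Var i ^ n * (g - h) \<in> base_ideal f" ..
qed

lemma sat_mem_form_part:
  assumes "\<And>i. is_form d (f i)" "sat_mem f h"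
  shows "sat_mem f (form_part n h)"
proof -
  obtain N where N: "\<And>p. is_form N p \<Longrightarrow> p * h \<in> base_ideal f"
    using assms(2) unfolding sat_mem_def by blast
  have "p * form_part n h \<in> base_ideal f" if "is_form N p" for p
  proof -
    have "form_part (n + N) (h * p) = form_part n h * p"
      using that by (rule form_part_mult)
    moreover have "form_part (n + N) (h * p) \<in> base_ideal f"
      using assms(1) N[OF that] by (intro form_part_base_ideal) (auto simp: mult.commute)
    ultimately show ?thesis by (simp add: mult.commute)
  qed
  then show ?thesis unfolding sat_mem_def by blast
qed

text \<open>
  An ideal generated by forms contains the homogeneous parts of its elements, and so does its
  saturation.
\<close>

lemma sat_mem_forms_suffice:
  assumes "\<And>i. is_form d (f i)"
    and forms: "\<And>n h. is_form n h \<Longrightarrow> sat_mem f h \<Longrightarrow> h \<in> base_ideal f"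
    and "sat_mem f h"
  shows "h \<in> base_ideal f"
proof -
  have "form_part n h \<in> base_ideal f" for n
    using sat_mem_form_part[OF assms(1) assms(3)] by (intro forms[of n]) auto
  then have "(\<Sum>n\<in>mon_degree ` Poly_Mapping.keys h. form_part n h) \<in> base_ideal f"
    by (intro is_ideal_sum is_ideal_base_ideal)
  then show ?thesis unfolding sum_form_parts[symmetric] .
qed

lemma monomial_Suc:
  assumes "mon_degree m = Suc n"
  obtains i m' where "Poly_Mapping.single m (1 :: 'k::comm_ring_1) = Var i * Poly_Mapping.single m' 1"
    "mon_degree m' = n"
proof -
  from assms obtain i where i: "expo m i \<noteq> 0"
    by (metis mon_degree_eq add_is_0 nat.distinct(1))
  define m' where "m' = m - Poly_Mapping.single i 1"
  have m: "m = Poly_Mapping.single i 1 + m'"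
    by (rule poly_mapping_eqI) (use i in \<open>auto simp: m'_def lookup_add lookup_minus lookup_single when_def\<close>)
  have "mon_degree (Poly_Mapping.single i 1) = 1"
    using exhaust_3[of i] by (auto simp: mon_degree_eq lookup_single)
  then have "mon_degree m' = n"
    using assms mon_degree_add[of "Poly_Mapping.single i 1" m'] m by simp
  moreover have "Poly_Mapping.single m (1 :: 'k) = Var i * Poly_Mapping.single m' 1"
    unfolding m Var_def by (simp add: mult_single)
  ultimately show thesis using that by blast
qed

lemma single_in_ideal_power:
  "mon_degree m = n \<Longrightarrow>
    Poly_Mapping.single m (1 :: 'k::field) \<in> ideal_power (ideal_generated (range Var)) n"
proof (induction n arbitrary: m)
  case (Suc n)
  from Suc.prems obtain i m' where "Poly_Mapping.single m (1 :: 'k) = Var i * Poly_Mapping.single m' 1"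
    and m': "mon_degree m' = n" by (rule monomial_Suc)
  moreover have "(Var i :: 'k poly3) \<in> ideal_generated (range Var)"
    by (rule ideal_generated_superset) simp
  ultimately show ?case
    using Suc.IH[OF m'] by (auto intro!: ideal_generated_superset)
qed simp

lemma forms_in_ideal_ge:
  fixes X :: "'k::field poly3 set"
  assumes X: "is_ideal X" "\<And>p. is_form k p \<Longrightarrow> p \<in> X" and "is_form (k + n) p"
  shows "p \<in> X"
proof -
  have "Poly_Mapping.single m 1 \<in> X" if "mon_degree m = k + n" for m
    using that
  proof (induction n arbitrary: m)
    case 0
    then show ?case by (intro X(2) is_form_single) simp
  next
    case (Suc n)
    then obtain i m' where "Poly_Mapping.single m (1 :: 'k) = Var i * Poly_Mapping.single m' 1"
      and "mon_degree m' = k + n" using monomial_Suc[of m "k + n"] by auto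
    then show ?case using Suc.IH is_ideal_mult[OF X(1)] by simp
  qed
  then show ?thesis using form_in_ideal[OF X(1) assms(3)] by blast
qed

lemma saturatedI:
  assumes "\<And>h. sat_mem f h \<Longrightarrow> h \<in> base_ideal f"
  shows "saturated (base_ideal f)"
proof -
  note I = is_ideal_base_ideal[of f]
  let ?m = "ideal_generated (range Var) :: 'a poly3 set"
  have "h \<in> base_ideal f" if "h \<in> ideal_saturation (base_ideal f) ?m" for h
  proof -
    from that obtain n where n: "\<And>a. a \<in> ideal_power ?m n \<Longrightarrow> h * a \<in> base_ideal f"
      unfolding ideal_saturation_def ideal_colon_def by blast
    have "p * h \<in> base_ideal f" if "is_form n p" for p
    proof -
      have "p \<in> {p. p * h \<in> base_ideal f}"
        using is_ideal_colon[OF I] that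
        by (rule form_in_ideal) (use n[OF single_in_ideal_power] in \<open>simp add: mult.commute\<close>)
      then show ?thesis by simp
    qed
    then show ?thesis using assms unfolding sat_mem_def by blast
  qed
  moreover have "h \<in> ideal_saturation (base_ideal f) ?m" if "h \<in> base_ideal f" for h
    unfolding ideal_saturation_def ideal_colon_def
    using is_ideal_mult'[OF I that] by auto
  ultimately show ?thesis unfolding saturated_def by blast
qed

subsection \<open>Linear changes of coordinates\<close>

definition linear_change :: "(3 \<Rightarrow> 'k::field poly3) \<Rightarrow> (3 \<Rightarrow> 'k poly3) \<Rightarrow> bool"
  where "linear_change A B \<longleftrightarrow> (\<forall>i. is_form (Suc 0) (A i) \<and> is_form (Suc 0) (B i) \<and>
    subst3 A (B i) = Var i \<and> subst3 B (A i) = Var i)"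

lemma linear_change_sym: "linear_change A B \<Longrightarrow> linear_change B A"
  by (simp add: linear_change_def)

lemma linear_change_inverse:
  assumes "linear_change A B"
  shows "subst3 A (subst3 B p) = p"
proof -
  have "(\<lambda>i. subst3 A (B i)) = Var" using assms by (simp add: linear_change_def fun_eq_iff)
  then show ?thesis by (simp add: subst3_subst3)
qed

lemma linear_change_form: "linear_change A B \<Longrightarrow> is_form d p \<Longrightarrow> is_form d (subst3 A p)"
  using is_form_subst3[of d p "Suc 0" A] by (simp add: linear_change_def)

lemma base_ideal_linear_change_iff:
  assumes "linear_change A B"
  shows "subst3 A p \<in> base_ideal (\<lambda>i. subst3 A (f i)) \<longleftrightarrow> p \<in> base_ideal f"
  using base_ideal_subst3[of p f A] base_ideal_subst3[of "subst3 A p" "\<lambda>i. subst3 A (f i)" B]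
  by (auto simp: linear_change_inverse[OF linear_change_sym[OF assms]])

lemma sat_mem_linear_change_iff:
  assumes "linear_change A B"
  shows "sat_mem (\<lambda>i. subst3 A (f i)) (subst3 A h) \<longleftrightarrow> sat_mem f h"
proof -
  note B = linear_change_sym[OF assms]
  have *: "p * subst3 A h = subst3 A (subst3 B p * h)" for p
    by (simp add: linear_change_inverse[OF assms])
  have "p * h \<in> base_ideal f \<longleftrightarrow> subst3 A p * subst3 A h \<in> base_ideal (\<lambda>i. subst3 A (f i))" for p
    using base_ideal_linear_change_iff[OF assms, of "p * h"] by simp
  then show ?thesis
    unfolding sat_mem_def
    by (metis linear_change_form[OF assms] linear_change_form[OF B] linear_change_inverse[OF assms])
qed

text \<open>
  The forms \<open>f\<^sub>i\<close> are a basis of the linear system of all curves of degree \<open>d\<close> that contain the base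
  scheme, and no curve of smaller degree contains it: an ideal generated in degree \<open>d\<close> has no nonzero
  element of smaller degree.
\<close>

definition complete_net :: "nat \<Rightarrow> (3 \<Rightarrow> 'k::field poly3) \<Rightarrow> bool"
  where "complete_net d f \<longleftrightarrow> (\<forall>i. is_form d (f i)) \<and>
    (\<forall>c. (\<Sum>i\<in>UNIV. Const (c i) * f i) = 0 \<longrightarrow> (\<forall>i. c i = 0)) \<and>
    (\<forall>n h. n \<le> d \<longrightarrow> is_form n h \<longrightarrow> sat_mem f h \<longrightarrow> h \<in> base_ideal f)"

lemma complete_net_form: "complete_net d f \<Longrightarrow> is_form d (f i)"
  and complete_net_indep: "complete_net d f \<Longrightarrow> (\<Sum>i\<in>UNIV. Const (c i) * f i) = 0 \<Longrightarrow> c i = 0"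
  and complete_net_sat: "complete_net d f \<Longrightarrow> n \<le> d \<Longrightarrow> is_form n h \<Longrightarrow> sat_mem f h \<Longrightarrow> h \<in> base_ideal f"
  by (auto simp: complete_net_def)

lemma complete_net_sat_less:
  "complete_net d f \<Longrightarrow> n < d \<Longrightarrow> is_form n h \<Longrightarrow> sat_mem f h \<Longrightarrow> h = 0"
  using form_in_base_ideal_less complete_net_form complete_net_sat by (metis less_imp_le)

lemma complete_net_linear_change:
  assumes A: "linear_change A B" and f: "complete_net d f"
  shows "complete_net d (\<lambda>i. subst3 A (f i))"
  unfolding complete_net_def
proof (intro conjI allI impI)
  show "is_form d (subst3 A (f i))" for i
    by (rule linear_change_form[OF A complete_net_form[OF f]])
next
  fix c i assume "(\<Sum>i\<in>UNIV. Const (c i) * subst3 A (f i)) = 0"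
  then have "subst3 B (subst3 A (\<Sum>i\<in>UNIV. Const (c i) * f i)) = 0" by simp
  then have "(\<Sum>i\<in>UNIV. Const (c i) * f i) = 0"
    by (simp only: linear_change_inverse[OF linear_change_sym[OF A]])
  then show "c i = 0" by (rule complete_net_indep[OF f])
next
  fix n h assume n: "n \<le> d" "is_form n h" "sat_mem (\<lambda>i. subst3 A (f i)) h"
  have h: "h = subst3 A (subst3 B h)" by (simp add: linear_change_inverse[OF A])
  have "sat_mem f (subst3 B h)"
    using n(3) sat_mem_linear_change_iff[OF A, of f "subst3 B h"] h by simp
  then have "subst3 B h \<in> base_ideal f"
    by (intro complete_net_sat[OF f n(1)] linear_change_form[OF linear_change_sym[OF A]] n(2))
  then show "h \<in> base_ideal (\<lambda>i. subst3 A (f i))"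
    using base_ideal_linear_change_iff[OF A, of "subst3 B h" f] h by simp
qed

lemma saturated_linear_change:
  assumes A: "linear_change A B"
    and "\<And>h. sat_mem (\<lambda>i. subst3 A (f i)) h \<Longrightarrow> h \<in> base_ideal (\<lambda>i. subst3 A (f i))"
    and "sat_mem f h"
  shows "h \<in> base_ideal f"
  using assms(2)[of "subst3 A h"] assms(3)
  by (simp add: sat_mem_linear_change_iff[OF A] base_ideal_linear_change_iff[OF A])

lemma no_fixed_part_linear_change:
  assumes A: "linear_change A B" and "no_fixed_part f"
  shows "no_fixed_part (\<lambda>i. subst3 A (f i))"
  unfolding no_fixed_part_def
proof (intro allI impI)
  fix h assume "\<forall>i. h dvd subst3 A (f i)"
  then have "subst3 B h dvd f i" for i
    using subst3.dvd[of h "subst3 A (f i)" B] by (simp add: linear_change_inverse[OF linear_change_sym[OF A]])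
  then have "subst3 B h dvd 1" using assms(2) by (simp add: no_fixed_part_def)
  then show "h dvd 1"
    using subst3.dvd[of "subst3 B h" 1 A] by (simp add: linear_change_inverse[OF A])
qed

section \<open>The net of a plane Cremona map is complete\<close>

lemma subst3_scale:
  assumes "is_form d p"
  shows "subst3 (\<lambda>i. c * v i) p = c ^ d * subst3 v p"
  using assms
proof (rule form_induct)
  fix m b assume "mon_degree m = d"
  then show "subst3 (\<lambda>i. c * v i) (Const b * Poly_Mapping.single m 1)
      = c ^ d * subst3 v (Const b * Poly_Mapping.single m 1)"
    by (auto simp: mon_degree_eq monomial_eq_prod prod_UNIV_3 power_mult_distrib power_add mult_ac)
qed (simp_all add: distrib_left)

lemma linear_form_eq_0:
  assumes "(\<Sum>i\<in>UNIV. Const (c i) * Var i) = (0 :: 'k::field poly3)"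
  shows "c i = 0"
proof -
  have id: "ring_morphism (\<lambda>x :: 'k. x)" by (simp add: ring_morphism_def)
  let ?e = "eval3 (\<lambda>x :: 'k. x) (\<lambda>j. if j = i then 1 else 0)"
  interpret e: ring_morphism ?e by (rule ring_morphism_eval3[OF id])
  have "?e (\<Sum>i\<in>UNIV. Const (c i) * Var i) = c i"
    using exhaust_3[of i] by (auto simp: sum_UNIV_3 id)
  then show ?thesis using assms by simp
qed

text \<open>
  The quotients of \<open>F\<^sub>i\<close> by \<open>x\<^sub>i\<close> agree; they are polynomials because different variables are
  coprime.
\<close>

lemma proportional_to_Var:
  assumes "same_rational_map F Var"
  obtains D :: "'k::field poly3" where "\<And>i. F i = D * Var i"
proof -
  have F: "Var j * F i = Var i * F j" for i j
    using assms by (simp add: same_rational_map_def mult.commute)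
  have "Var 0 dvd F 0"
    using F[of 0 1] by (intro Var_dvd_cancel_Var[of 0 "F 1" 1]) auto
  then obtain D where D: "F 0 = Var 0 * D" by (elim dvdE)
  have "F i = D * Var i" for i
  proof -
    have "Var 0 * F i = Var 0 * (D * Var i)"
      using F[of 0 i] by (simp add: D mult_ac)
    then show ?thesis by (simp only: mult_cancel_left Var_neq_0 simp_thms)
  qed
  then show thesis by (rule that)
qed

text \<open>
  Mutually inverse rational maps, with the common factors \<open>D\<close> and \<open>D'\<close> that the two composites
  acquire.
\<close>

locale cremona =
  fixes d :: nat and f :: "3 \<Rightarrow> 'k::field poly3" and e :: nat and g :: "3 \<Rightarrow> 'k poly3"
    and D D' :: "'k poly3"
  assumes f: "is_form d (f i)" and g: "is_form e (g i)"
    and fg: "subst3 g (f i) = D * Var i" and gf: "subst3 f (g i) = D' * Var i"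
    and D: "D \<noteq> 0" and D': "D' \<noteq> 0"
begin

text \<open>
  Substituting \<open>f\<close> into \<open>p(g) = 0\<close> gives \<open>p(D' x\<^sub>0, D' x\<^sub>1, D' x\<^sub>2) = 0\<close>, which is a power of \<open>D'\<close>
  times \<open>p\<close>.
\<close>

lemma subst3_g_eq_0:
  assumes "is_form n p" "subst3 g p = 0"
  shows "p = 0"
proof -
  have "0 = subst3 f (subst3 g p)" by (simp add: assms)
  also have "\<dots> = subst3 (\<lambda>i. D' * Var i) p"
    by (simp add: subst3_subst3 gf)
  also have "\<dots> = D' ^ n * p" by (simp add: subst3_scale[OF assms(1)])
  finally show ?thesis using D' by simp
qed

lemma independent:
  assumes "(\<Sum>i\<in>UNIV. Const (c i) * f i) = 0"
  shows "c i = 0"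
proof -
  have "0 = subst3 g (\<Sum>i\<in>UNIV. Const (c i) * f i)" by (simp add: assms)
  also have "\<dots> = D * (\<Sum>i\<in>UNIV. Const (c i) * Var i)"
    by (simp add: fg sum_distrib_left mult_ac)
  finally have "(\<Sum>i\<in>UNIV. Const (c i) * Var i) = (0 :: 'k poly3)" using D by simp
  then show ?thesis by (rule linear_form_eq_0)
qed

text \<open>
  Write \<open>g = c g'\<close> with \<open>g'\<close> free of common factors. Then \<open>f\<^sub>i(g') = D\<^sub>1 x\<^sub>i\<close>, and a relation
  \<open>x\<^sub>i\<^sup>N h \<in> I\<close> turns into \<open>D\<^sub>1\<close> divides \<open>g'\<^sub>i\<^sup>N h(g')\<close>. Both \<open>D\<close> and \<open>h(g)\<close> arise from their
  counterparts for \<open>g'\<close> through the factor \<open>c\<^sup>d\<close>.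
\<close>

lemma D_dvd_subst3_sat_mem:
  assumes h: "sat_mem f h" "is_form d h"
  shows "D dvd subst3 g h"
proof -
  obtain N where N: "\<And>p. is_form N p \<Longrightarrow> p * h \<in> base_ideal f"
    using h(1) unfolding sat_mem_def by blast
  have "\<exists>i. g i \<noteq> 0"
  proof (rule ccontr)
    assume "\<not> ?thesis"
    then have "subst3 f (g 0) = 0" by simp
    then show False using gf[of 0] D' by simp
  qed
  then obtain c g' where g': "\<And>i. g i = c * g' i"
    and dvd: "\<And>D q n. (\<And>i. D dvd g' i ^ n * q) \<Longrightarrow> D dvd q"
    using common_factor_split[of g] by metis
  have subst_g: "subst3 g p = c ^ d * subst3 g' p" if "is_form d p" for p
    using subst3_scale[OF that, of c g'] by (simp add: g'[symmetric])
  have "D * Var 0 = c ^ d * subst3 g' (f 0)" using subst_g[OF f] fg by metis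
  then have c: "c ^ d \<noteq> 0" using D by (metis Var_neq_0 mult_eq_0_iff)
  have X: "c ^ d * subst3 g' (f i) = D * Var i" for i using subst_g[OF f, of i] fg[of i] by simp
  have "same_rational_map (\<lambda>i. subst3 g' (f i)) Var"
    unfolding same_rational_map_def
  proof (intro allI)
    fix i j
    have "c ^ d * (subst3 g' (f i) * Var j) = c ^ d * (subst3 g' (f j) * Var i)"
      by (simp only: mult.assoc[symmetric] X) (simp only: mult.assoc mult.commute[of "Var i"])
    then show "subst3 g' (f i) * Var j = subst3 g' (f j) * Var i"
      using c mult_left_cancel by blast
  qed
  then obtain D1 where D1: "\<And>i. subst3 g' (f i) = D1 * Var i"
    by (rule proportional_to_Var[of "\<lambda>i. subst3 g' (f i)"]) blast
  have "D * Var 0 = c ^ d * D1 * Var 0"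
    using \<open>D * Var 0 = c ^ d * subst3 g' (f 0)\<close> D1 by (simp add: mult.assoc)
  then have D_eq: "D = c ^ d * D1" by (simp only: mult_cancel_right Var_neq_0 simp_thms)
  have "D1 dvd g' i ^ N * subst3 g' h" for i
  proof -
    obtain a where "Var i ^ N * h = (\<Sum>j\<in>UNIV. a j * f j)"
      using N[of "Var i ^ N"] by (auto elim: base_idealE)
    then have "subst3 g' (Var i ^ N * h) = (\<Sum>j\<in>UNIV. subst3 g' (a j) * (D1 * Var j))"
      by (simp add: D1)
    then have "g' i ^ N * subst3 g' h = D1 * (\<Sum>j\<in>UNIV. subst3 g' (a j) * Var j)"
      by (simp add: sum_distrib_left mult_ac)
    then show ?thesis by simp
  qed
  then have "D1 dvd subst3 g' h" by (rule dvd)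
  then show ?thesis
    unfolding D_eq using subst_g[of h] h(2) by (auto intro: mult_dvd_mono)
qed

text \<open>
  The quotient of \<open>h(g)\<close> by \<open>D\<close> has degree \<open>1\<close>. Multiplication by \<open>x\<^sub>0\<close> exhibits this without
  the degree of \<open>D\<close>, since \<open>D x\<^sub>0 = f\<^sub>0(g)\<close> has the same degree as \<open>h(g)\<close>.
\<close>

lemma sat_mem_degree_d:
  assumes "is_form d h" "sat_mem f h"
  obtains c where "h = (\<Sum>i\<in>UNIV. Const (c i) * f i)"
proof -
  have "D dvd subst3 g h" using assms by (intro D_dvd_subst3_sat_mem)
  then obtain l where l: "subst3 g h = D * l" by (elim dvdE)
  define l1 where "l1 = form_part 1 l"
  have h: "is_form (d * e) (subst3 g h)" by (rule is_form_subst3[OF assms(1) g])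
  have D: "is_form (d * e) (D * Var 0)"
    unfolding fg[symmetric] by (rule is_form_subst3[OF f g])
  have "Var 0 * subst3 g h = form_part (1 + d * e) (Var 0 * subst3 g h)"
    using is_form_mult[OF is_form_Var h, of 0] by (simp add: form_part_form)
  also have "\<dots> = form_part (1 + d * e) (l * (D * Var 0))"
    by (simp add: l mult_ac)
  also have "\<dots> = l1 * (D * Var 0)"
    unfolding l1_def by (rule form_part_mult[OF D])
  finally have "Var 0 * subst3 g h = Var 0 * (D * l1)" by (simp add: mult_ac)
  then have h_eq: "subst3 g h = D * l1" by (simp only: mult_cancel_left Var_neq_0 simp_thms)
  obtain c where c: "l1 = (\<Sum>i\<in>UNIV. Const (c i) * Var i)"
    using linear_form_eq[of l1] unfolding l1_def by auto
  have "subst3 g (h - (\<Sum>i\<in>UNIV. Const (c i) * f i)) = 0"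
    by (simp add: h_eq c fg sum_distrib_left mult_ac)
  moreover have "is_form d (h - (\<Sum>i\<in>UNIV. Const (c i) * f i))"
    by (intro is_form_diff is_form_sum is_form_Const_mult f assms)
  ultimately have "h - (\<Sum>i\<in>UNIV. Const (c i) * f i) = 0" by (rule subst3_g_eq_0[rotated])
  then show thesis using that by simp
qed

text \<open>
  If \<open>h\<close> is a form of degree \<open>d - 1\<close> in the saturation, the three forms \<open>x\<^sub>i h\<close> are linear
  combinations of the three forms \<open>f\<^sub>j\<close>, hence span the same space, and \<open>h\<close> is a common factor.
\<close>

lemma sat_mem_less:
  assumes "no_fixed_part f" "2 \<le> d" "n < d" "is_form n h" "sat_mem f h"
  shows "h = 0"
proof (rule ccontr)
  assume "h \<noteq> 0"
  define h' where "h' = Var 0 ^ (d - 1 - n) * h"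
  have h': "h' \<noteq> 0" "sat_mem f h'"
    using \<open>h \<noteq> 0\<close> assms(5) by (auto simp: h'_def intro: sat_mem_mult)
  have "is_form (d - 1 - n + n) h'"
    unfolding h'_def by (intro is_form_mult assms is_form_Var_power)
  then have form: "is_form (d - 1) h'" using assms by simp
  have "is_form d (Var i * h')" for i
    using is_form_mult[OF is_form_Var form, of i] assms(2) by simp
  then have "\<forall>i. \<exists>c. Var i * h' = (\<Sum>j\<in>UNIV. Const (c j) * f j)"
    using sat_mem_degree_d sat_mem_mult[OF h'(2)] by metis
  then obtain C where C: "\<And>i. Var i * h' = (\<Sum>j\<in>UNIV. Const (C i j) * f j)" by metis
  have "h' dvd f s" for s
  proof -
    \<comment> \<open>Three equations in four unknowns: the additional unknown is the coefficient of \<open>f\<^sub>s\<close>.\<close>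
    let ?c = "\<lambda>j. case_option (if j = s then 1 else 0) (\<lambda>i. C i j)"
    have UNIV_opt: "(UNIV :: 3 option set) = insert None (Some ` UNIV)" by (rule UNIV_option_conv)
    have sum_opt: "(\<Sum>x\<in>(UNIV :: 3 option set). F x) = F None + (\<Sum>i\<in>UNIV. F (Some i))"
      for F :: "3 option \<Rightarrow> 'k"
      unfolding UNIV_opt by (simp add: sum.reindex)
    have "card (UNIV :: 3 set) < card (UNIV :: 3 option set)"
      by (simp add: card_UNIV_option)
    from underdetermined_system[OF finite_class.finite_UNIV finite_class.finite_UNIV this, of ?c]
    obtain a where a: "\<exists>x. a x \<noteq> 0" "\<And>j. (\<Sum>x\<in>UNIV. ?c j x * a x) = 0" by blast
    have a': "(\<Sum>i\<in>UNIV. a (Some i) * C i j) = - (if j = s then a None else 0)" for j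
      using a(2)[of j] unfolding sum_opt
      by (cases "j = s") (simp_all add: mult.commute eq_neg_iff_add_eq_0 add.commute)
    let ?l = "\<Sum>i\<in>UNIV. Const (a (Some i)) * Var i"
    have "?l * h' = (\<Sum>i\<in>UNIV. Const (a (Some i)) * (\<Sum>j\<in>UNIV. Const (C i j) * f j))"
      by (simp add: sum_distrib_right mult.assoc C)
    also have "\<dots> = (\<Sum>j\<in>UNIV. \<Sum>i\<in>UNIV. Const (a (Some i) * C i j) * f j)"
      by (subst sum.swap) (simp add: sum_distrib_left mult.assoc)
    also have "\<dots> = (\<Sum>j\<in>UNIV. Const (\<Sum>i\<in>UNIV. a (Some i) * C i j) * f j)"
      by (simp add: sum_distrib_right)
    also have "\<dots> = (\<Sum>j\<in>UNIV. if j = s then - Const (a None) * f s else 0)"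
      unfolding a' by (rule sum.cong) auto
    also have "\<dots> = - Const (a None) * f s" by simp
    finally have l: "?l * h' = - Const (a None) * f s" .
    have "a None \<noteq> 0"
    proof
      assume z: "a None = 0"
      then have "?l = 0" using l h'(1) by simp
      then have "a (Some i) = 0" for i by (rule linear_form_eq_0)
      then show False using a(1) z by (metis option.exhaust)
    qed
    then have one: "inverse (- a None) * - a None = 1" by simp
    have "Const (inverse (- a None)) * (?l * h') = Const (inverse (- a None) * - a None) * f s"
      unfolding l Const.mult Const.uminus by (rule mult.assoc[symmetric])
    then have "f s = Const (inverse (- a None)) * ?l * h'"
      unfolding one Const.one by (simp only: mult_1 mult.assoc)
    then show ?thesis by simp
  qed
  then have "h' dvd 1" using assms(1) by (simp add: no_fixed_part_def)
  then show False using is_form_unit[OF form] assms(2) by simp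
qed

lemma complete_net:
  assumes "no_fixed_part f" "2 \<le> d"
  shows "complete_net d f"
  unfolding complete_net_def
proof (intro conjI allI impI)
  fix n h assume h: "n \<le> d" "is_form n h" "sat_mem f h"
  show "h \<in> base_ideal f"
  proof (cases "n = d")
    case True
    with h obtain c where "h = (\<Sum>i\<in>UNIV. Const (c i) * f i)"
      using sat_mem_degree_d by blast
    then show ?thesis using base_idealI by simp
  next
    case False
    then show ?thesis
      using sat_mem_less[OF assms, of n h] h is_ideal_0[OF is_ideal_base_ideal] by simp
  qed
qed (use f independent in auto)

end

lemma plane_cremona_map_complete_net:
  assumes "plane_cremona_map d f" "2 \<le> d"
  shows "complete_net d f"
proof -
  from assms(1) obtain e g where df: "represents_rational_map d f" "no_fixed_part f"
    and dg: "represents_rational_map e g" "left_inverse_rational_map g f" "left_inverse_rational_map f g"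
    unfolding plane_cremona_map_def birational_def by blast
  obtain D where D: "\<And>i. compose3 f g i = D * Var i"
    using dg(3) proportional_to_Var unfolding left_inverse_rational_map_def by blast
  obtain D' where D': "\<And>i. compose3 g f i = D' * Var i"
    using dg(2) proportional_to_Var unfolding left_inverse_rational_map_def by blast
  have "D \<noteq> 0" "D' \<noteq> 0"
    using dg(2,3) D D' unfolding left_inverse_rational_map_def by auto
  then interpret cremona d f e g D D'
    using df(1) dg(1) D D' by unfold_locales (auto simp: represents_rational_map_def compose3_def)
  show ?thesis using df(2) assms(2) by (rule complete_net)
qed

section \<open>A line that misses the base points\<close>

text \<open>
  The ideal generated by the \<open>f\<^sub>i\<close> and \<open>x\<^sub>2\<close>; modulo \<open>x\<^sub>2\<close> it is the ideal of the restrictions of the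
  \<open>f\<^sub>i\<close> to the line \<open>x\<^sub>2 = 0\<close>.
\<close>

definition mod_last :: "(3 \<Rightarrow> 'k::field poly3) \<Rightarrow> 'k poly3 set"
  where "mod_last f = {p. \<exists>b. p - Var 2 * b \<in> base_ideal f}"

lemma mod_lastI: "p - Var 2 * b \<in> base_ideal f \<Longrightarrow> p \<in> mod_last f"
  unfolding mod_last_def by blast

lemma is_ideal_mod_last: "is_ideal (mod_last f)"
  unfolding is_ideal_def
proof (intro conjI ballI allI)
  note I = is_ideal_base_ideal[of f]
  show "0 \<in> mod_last f" by (rule mod_lastI[of _ 0]) (simp add: is_ideal_0[OF I])
  show "p + q \<in> mod_last f" if pq: "p \<in> mod_last f" "q \<in> mod_last f" for p q
  proof -
    from pq obtain a b where "p - Var 2 * a \<in> base_ideal f" "q - Var 2 * b \<in> base_ideal f"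
      unfolding mod_last_def by blast
    then have "(p - Var 2 * a) + (q - Var 2 * b) \<in> base_ideal f" by (rule is_ideal_add[OF I])
    also have "(p - Var 2 * a) + (q - Var 2 * b) = p + q - Var 2 * (a + b)" by (simp add: distrib_left)
    finally show ?thesis by (rule mod_lastI)
  qed
  show "r * p \<in> mod_last f" if p: "p \<in> mod_last f" for p r
  proof -
    from p obtain a where "p - Var 2 * a \<in> base_ideal f"
      unfolding mod_last_def by blast
    then have "r * (p - Var 2 * a) \<in> base_ideal f" by (rule is_ideal_mult[OF I])
    also have "r * (p - Var 2 * a) = r * p - Var 2 * (r * a)" by (simp add: right_diff_distrib mult_ac)
    finally show ?thesis by (rule mod_lastI)
  qed
qed

lemma base_ideal_mod_last: "p \<in> base_ideal f \<Longrightarrow> p \<in> mod_last f"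
  by (rule mod_lastI[of _ 0]) simp

lemma Var_2_mod_last: "Var 2 \<in> mod_last f"
  by (rule mod_lastI[of _ 1]) (simp add: is_ideal_0[OF is_ideal_base_ideal])

lemma kill_2_mod_last: "kill 2 p \<in> mod_last f \<longleftrightarrow> p \<in> mod_last f"
proof -
  obtain c where c: "p = kill 2 p + Var 2 * c" by (rule kill_decomp)
  have "Var 2 * c \<in> mod_last f" by (rule is_ideal_mult'[OF is_ideal_mod_last Var_2_mod_last])
  then show ?thesis
    using c is_ideal_add[OF is_ideal_mod_last] is_ideal_diff[OF is_ideal_mod_last]
    by (metis add_diff_cancel_right')
qed

text \<open>
  Over an algebraically closed field, the Nullstellensatz translates this condition into: the line
  \<open>x\<^sub>2 = 0\<close> contains no common zero of the \<open>f\<^sub>i\<close>.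
\<close>

definition last_line_free :: "(3 \<Rightarrow> 'k::field poly3) \<Rightarrow> bool"
  where "last_line_free f \<longleftrightarrow> (\<exists>M. \<forall>p. is_form M p \<longrightarrow> p \<in> mod_last f)"

lemma last_line_freeI:
  fixes f :: "3 \<Rightarrow> 'k::field poly3"
  assumes "Var 0 ^ M \<in> mod_last f" "Var 1 ^ N \<in> mod_last f"
  shows "last_line_free f"
  unfolding last_line_free_def
proof (intro exI allI impI)
  fix p :: "'k poly3" assume "is_form (M + N + 1) p"
  then show "p \<in> mod_last f"
  proof (rule form_in_ideal[OF is_ideal_mod_last])
    fix m assume "mon_degree m = M + N + 1"
    then have "M \<le> expo m 0 \<or> N \<le> expo m 1 \<or> 1 \<le> expo m 2"
      by (auto simp: mon_degree_eq)
    then show "Poly_Mapping.single m 1 \<in> mod_last f"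
      using assms Var_2_mod_last[of f] monomial_in_ideal[OF is_ideal_mod_last, of 2 1 f m]
      by (auto intro: monomial_in_ideal[OF is_ideal_mod_last])
  qed
qed

lemma linear_change_comp:
  assumes "linear_change A B" "linear_change A' B'"
  shows "linear_change (\<lambda>i. subst3 A' (A i)) (\<lambda>i. subst3 B (B' i))"
proof -
  note inv = linear_change_inverse[OF assms(1)] linear_change_inverse[OF assms(2)]
    linear_change_inverse[OF linear_change_sym[OF assms(1)]]
    linear_change_inverse[OF linear_change_sym[OF assms(2)]]
  have "is_form (Suc 0) (subst3 A' (A i))" "is_form (Suc 0) (subst3 B (B' i))" for i
    using assms linear_change_form[OF assms(2)] linear_change_form[OF linear_change_sym[OF assms(1)]]
    by (auto simp: linear_change_def)
  moreover have "subst3 (\<lambda>i. subst3 A' (A i)) (subst3 B (B' i)) = Var i"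
    "subst3 (\<lambda>i. subst3 B (B' i)) (subst3 A' (A i)) = Var i" for i
    using assms by (simp_all add: subst3_subst3[symmetric] inv linear_change_def)
  ultimately show ?thesis unfolding linear_change_def by blast
qed

lemma subst3_Const_point: "subst3 (\<lambda>i. Const (a i)) p = Const (eval3 (\<lambda>x. x) a p)"
proof -
  have id: "ring_morphism (\<lambda>x :: 'a. x)" by (simp add: ring_morphism_def)
  show ?thesis
    by (rule ring_morphism_eqI[where \<psi> = "\<lambda>p. Const (eval3 (\<lambda>x. x) a p)"])
       (auto intro: ring_morphism_comp[OF ring_morphism_Const ring_morphism_eval3[OF id]]
          ring_morphism_subst3 simp: id)
qed

lemma subst3_point_line:
  assumes "is_form d p"
  shows "subst3 (\<lambda>i. Const (a i) * y) p = Const (eval3 (\<lambda>x. x) a p) * y ^ d"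
  using subst3_scale[OF assms, of y "\<lambda>i. Const (a i)"]
  by (simp add: subst3_Const_point mult.commute)

lemma subst3_cong_expo:
  assumes "\<And>m i. coeff3 p m \<noteq> 0 \<Longrightarrow> expo m i \<noteq> 0 \<Longrightarrow> v i = w i"
  shows "subst3 v p = subst3 w p"
  unfolding subst3_def
proof (intro sum.cong refl arg_cong2[where f = "(*)"] prod.cong)
  fix m i assume "m \<in> Poly_Mapping.keys p"
  then show "v i ^ expo m i = w i ^ expo m i"
    using assms[of m i] by (cases "expo m i = 0") (auto simp: in_keys_iff)
qed

lemma diff_dvd_power_diff: "(x - y) dvd (x ^ n - y ^ n :: 'a::comm_ring_1)"
proof (induction n)
  case (Suc n)
  have "x ^ Suc n - y ^ Suc n = x * (x ^ n - y ^ n) + (x - y) * y ^ n"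
    by (simp add: algebra_simps)
  then show ?case using Suc by simp
qed simp

text \<open>
  Coprimality of the \<open>f\<^sub>i\<close> puts a nonzero form in two of the variables into the ideal. Together with
  a point outside the base locus it supplies the line, as the two coordinate changes in the proof
  show.
\<close>

lemma exists_line_free_coordinates:
  fixes f :: "3 \<Rightarrow> 'k::field poly3"
  assumes inf: "infinite (UNIV :: 'k set)"
    and f: "\<And>i. is_form d (f i)" "no_fixed_part f" "f s \<noteq> 0"
  obtains A B where "linear_change A B" "last_line_free (\<lambda>i. subst3 A (f i))"
proof -
  have id: "ring_morphism (\<lambda>x :: 'k. x)" by (simp add: ring_morphism_def)
  note ev = ring_morphism.mult[OF ring_morphism_eval3[OF id]]
  define v where "v = (Var(1 := 0, 2 := 0) :: 3 \<Rightarrow> 'k poly3)"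
  have v [simp]: "v 0 = Var 0" "v 1 = 0" "v 2 = 0" by (simp_all add: v_def)
  \<comment> \<open>Move a point outside the base locus to the point where \<open>x\<^sub>1\<close> and \<open>x\<^sub>2\<close> vanish.\<close>
  have "Var 0 * f s \<noteq> 0" using f(3) by simp
  then obtain a where "eval3 (\<lambda>x. x) a (Var 0 * f s) \<noteq> 0" using exists_eval3_neq_0[OF inf] by blast
  then have a: "a 0 \<noteq> 0" "eval3 (\<lambda>x. x) a (f s) \<noteq> 0" by (auto simp: ev id)
  define A1 where "A1 = (\<lambda>i :: 3. if i = 0 then Const (a 0) * Var 0 else Var i + Const (a i) * Var 0)"
  define B1 where "B1 = (\<lambda>i :: 3. if i = 0 then Const (1 / a 0) * Var 0 else Var i - Const (a i / a 0) * Var 0)"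
  have A1: "linear_change A1 B1"
    unfolding linear_change_def
    using a(1) by (auto simp: A1_def B1_def mult.assoc[symmetric] simp flip: Const.mult
        intro!: is_form_add is_form_diff is_form_Const_mult)
  define f1 where "f1 = (\<lambda>i. subst3 A1 (f i))"
  have f1: "no_fixed_part f1" "\<And>i. is_form d (f1 i)"
    unfolding f1_def using no_fixed_part_linear_change[OF A1 f(2)] linear_change_form[OF A1 f(1)] by auto
  have "(\<lambda>i. subst3 v (A1 i)) = (\<lambda>i. Const (a i) * Var 0)"
    by (rule ext) (use exhaust_3 in \<open>auto simp: A1_def v_def\<close>)
  then have v_f1: "subst3 v (f1 s) = Const (eval3 (\<lambda>x. x) a (f s)) * Var 0 ^ d"
    by (simp add: f1_def subst3_subst3 subst3_point_line[OF f(1)])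
  have "f1 s \<noteq> 0" using v_f1 a(2) by auto
  then have nz: "\<exists>i. f1 i \<noteq> 0" by blast
  \<comment> \<open>A form in \<open>x\<^sub>1, x\<^sub>2\<close> alone that vanishes on the base locus. Its zeros are lines through the moved
    point; every other line through that point meets them only there, outside the base locus.\<close>
  obtain \<alpha> r where r: "(\<Sum>i\<in>UNIV. \<alpha> i * f1 i) = r" "r \<noteq> 0" "\<And>m. coeff3 r m \<noteq> 0 \<Longrightarrow> expo m 0 = 0"
    using no_fixed_part_elimination[OF f1(1) nz] by blast
  have "\<exists>N. form_part N r \<noteq> 0"
  proof (rule ccontr)
    assume "\<not> ?thesis"
    then have "(\<Sum>d\<in>mon_degree ` Poly_Mapping.keys r. form_part d r) = 0" by simp
    then show False using r(2) unfolding sum_form_parts[symmetric] by simp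
  qed
  then obtain N where N: "form_part N r \<noteq> 0" by blast
  define q where "q = form_part N r"
  have q: "is_form N q" "q \<in> base_ideal f1" "\<And>m. coeff3 q m \<noteq> 0 \<Longrightarrow> expo m 0 = 0"
    using form_part_base_ideal[OF f1(2), where p = r and n = N] base_idealI[of \<alpha> f1] r
    by (auto simp: q_def coeff3_form_part split: if_splits)
  have "Var 1 * q \<noteq> 0" using N q_def by simp
  then obtain b where "eval3 (\<lambda>x. x) b (Var 1 * q) \<noteq> 0" using exists_eval3_neq_0[OF inf] by blast
  then have b: "b 1 \<noteq> 0" "eval3 (\<lambda>x. x) b q \<noteq> 0" by (auto simp: ev id)
  define A2 where "A2 = (\<lambda>i :: 3. if i = 0 then Var 0 else if i = 1 then Const (b 1) * Var 1
    else Var 2 + Const (b 2) * Var 1)"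
  define B2 where "B2 = (\<lambda>i :: 3. if i = 0 then Var 0 else if i = 1 then Const (1 / b 1) * Var 1
    else Var 2 - Const (b 2 / b 1) * Var 1)"
  have "subst3 A2 (B2 i) = Var i \<and> subst3 B2 (A2 i) = Var i" for i
    using exhaust_3[of i] b(1)
    by (auto simp: A2_def B2_def mult.assoc[symmetric] simp flip: Const.mult)
  then have A2: "linear_change A2 B2"
    unfolding linear_change_def
    by (auto simp: A2_def B2_def intro!: is_form_add is_form_diff is_form_Const_mult)
  define f2 where "f2 = (\<lambda>i. subst3 A2 (f1 i))"
  note J = is_ideal_mod_last[of f2]
  have "kill 2 (subst3 A2 q) = subst3 (\<lambda>i. Const (b i) * Var 1) q"
    unfolding subst3_subst3
  proof (rule subst3_cong_expo)
    fix m i assume "coeff3 q m \<noteq> 0" "expo m i \<noteq> 0"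
    then have "i \<noteq> 0" using q(3) by auto
    then show "kill 2 (A2 i) = Const (b i) * Var 1"
      using exhaust_3[of i] by (auto simp: A2_def)
  qed
  also have "\<dots> = Const (eval3 (\<lambda>x. x) b q) * Var 1 ^ N"
    by (rule subst3_point_line[OF q(1)])
  finally have "kill 2 (subst3 A2 q) = Const (eval3 (\<lambda>x. x) b q) * Var 1 ^ N" .
  moreover have "kill 2 (subst3 A2 q) \<in> mod_last f2"
    unfolding kill_2_mod_last f2_def by (intro base_ideal_mod_last base_ideal_subst3 q(2))
  ultimately have "Const (1 / eval3 (\<lambda>x. x) b q) * (Const (eval3 (\<lambda>x. x) b q) * Var 1 ^ N) \<in> mod_last f2"
    using is_ideal_mult[OF J] by metis
  then have x1: "Var 1 ^ N \<in> mod_last f2"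
    using b(2) by (simp add: mult.assoc[symmetric] flip: Const.mult)
  define c where "c = eval3 (\<lambda>x. x) a (f s)"
  have "(\<lambda>i. subst3 v (A2 i)) = v"
    by (rule ext) (use exhaust_3 in \<open>auto simp: A2_def v_def\<close>)
  then have v_f2: "subst3 v (f2 s) = Const c * Var 0 ^ d"
    using v_f1 by (simp add: f2_def subst3_subst3 c_def)
  obtain w where "f2 s - subst3 v (f2 s) = (\<Sum>i\<in>UNIV. w i * (Var i - v i))"
    using diff_subst3 by blast
  then have eq: "f2 s = Const c * Var 0 ^ d + w 1 * Var 1 + w 2 * Var 2"
    by (simp add: sum_UNIV_3 v_f2 algebra_simps)
  have "f2 s - w 2 * Var 2 \<in> mod_last f2"
    using is_ideal_mult[OF J Var_2_mod_last] base_ideal_mod_last[OF base_ideal_gen]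
    by (intro is_ideal_diff[OF J]) auto
  then have "Const c * Var 0 ^ d - (- (w 1 * Var 1)) \<in> mod_last f2"
    unfolding eq by simp
  then have "(Const c * Var 0 ^ d) ^ N - (- (w 1 * Var 1)) ^ N \<in> mod_last f2"
    using diff_dvd_power_diff[of "Const c * Var 0 ^ d" "- (w 1 * Var 1)" N] is_ideal_mult'[OF J]
    by (metis dvdE)
  moreover have "(- (w 1 * Var 1)) ^ N \<in> mod_last f2"
    using is_ideal_mult[OF J x1, of "(- w 1) ^ N"] by (simp flip: power_mult_distrib)
  ultimately have "(Const c * Var 0 ^ d) ^ N \<in> mod_last f2"
    using is_ideal_add[OF J] by (metis diff_add_cancel)
  then have "Const (inverse c) ^ N * (Const c * Var 0 ^ d) ^ N \<in> mod_last f2"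
    by (rule is_ideal_mult[OF J])
  moreover have "Const (inverse c) * (Const c * Var 0 ^ d) = Var 0 ^ d"
    unfolding mult.assoc[symmetric] Const.mult[symmetric] using a(2) by (simp add: c_def)
  then have "Const (inverse c) ^ N * (Const c * Var 0 ^ d) ^ N = Var 0 ^ (d * N)"
    by (simp only: power_mult_distrib[symmetric] power_mult)
  ultimately have x0: "Var 0 ^ (d * N) \<in> mod_last f2" by simp
  have "last_line_free f2" by (rule last_line_freeI[OF x0 x1])
  then have "last_line_free (\<lambda>i. subst3 (\<lambda>i. subst3 A2 (A1 i)) (f i))"
    by (simp add: f2_def f1_def subst3_subst3)
  with linear_change_comp[OF A1 A2] show thesis by (rule that)
qed

section \<open>Restriction to the line\<close>

lemma is_form_Var_cancel:
  assumes "is_form (Suc n) (Var i * b :: 'k::field poly3)"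
  shows "is_form n b"
proof -
  have "Var i * b = form_part (n + Suc 0) (b * Var i)"
    using assms by (simp add: form_part_form mult.commute)
  also have "\<dots> = Var i * form_part n b"
    by (simp only: form_part_mult[OF is_form_Var] mult.commute)
  finally have "b = form_part n b" by (simp only: mult_cancel_left Var_neq_0 simp_thms)
  then show ?thesis using is_form_form_part by metis
qed

lemma coeff3_kill: "coeff3 (kill i p) m = (if expo m i = 0 then coeff3 p m else 0)"
proof (induction p rule: monomial_induct)
  case (monomial n c)
  have "kill i (Poly_Mapping.single n c) = Const c * (\<Prod>j\<in>UNIV. (Var(i := 0)) j ^ expo n j)"
    by (simp add: subst3_eq_eval3 eval3_single)
  also have "\<dots> = (if expo n i = 0 then Poly_Mapping.single n c else 0)"
  proof (cases "expo n i = 0")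
    case True
    then have "(\<Prod>j\<in>UNIV. (Var(i := 0)) j ^ expo n j) = (\<Prod>j\<in>UNIV. Var j ^ expo n j :: 'a poly3)"
      by (intro prod.cong) auto
    then show ?thesis
      using True by (simp add: monomial_eq_prod[symmetric] monomial_eq_Const_mult[symmetric])
  next
    case False
    then have "(\<Prod>j\<in>UNIV. (Var(i := 0)) j ^ expo n j) = (0 :: 'a poly3)"
      using exhaust_3[of i] by (auto simp: prod_UNIV_3 zero_power)
    then show ?thesis using False by simp
  qed
  finally have eq: "kill i (Poly_Mapping.single n c) = (if expo n i = 0 then Poly_Mapping.single n c else 0)" .
  show ?case unfolding eq by (auto simp: lookup_single when_def)
qed (simp add: lookup_add)

text \<open>
  Modulo \<open>I\<close> a high power of \<open>x\<^sub>i\<close> is a multiple of \<open>x\<^sub>2\<close>, so what kills \<open>x\<^sub>2 h\<close> yields something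
  that kills \<open>h\<close>.
\<close>

lemma sat_mem_cancel_Var_2:
  assumes "last_line_free f" "sat_mem f (Var 2 * h)"
  shows "sat_mem f h"
proof (rule sat_memI_Var_powers)
  fix i
  note I = is_ideal_base_ideal[of f]
  obtain N where N: "\<And>p. is_form N p \<Longrightarrow> p * (Var 2 * h) \<in> base_ideal f"
    using assms(2) unfolding sat_mem_def by blast
  obtain M where "\<And>p. is_form M p \<Longrightarrow> p \<in> mod_last f"
    using assms(1) unfolding last_line_free_def by blast
  then have "Var i ^ M \<in> mod_last f" by simp
  then obtain b where b: "Var i ^ M - Var 2 * b \<in> base_ideal f"
    unfolding mod_last_def by blast
  have "Var i ^ N * h * (Var i ^ M - Var 2 * b) + b * (Var i ^ N * (Var 2 * h)) \<in> base_ideal f"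
    by (intro is_ideal_add[OF I] is_ideal_mult[OF I] b N is_form_Var_power)
  also have "Var i ^ N * h * (Var i ^ M - Var 2 * b) + b * (Var i ^ N * (Var 2 * h)) = Var i ^ (N + M) * h"
    by (simp add: power_add algebra_simps)
  finally show "\<exists>n. Var i ^ n * h \<in> base_ideal f" ..
qed

text \<open>
  A linear combination of the \<open>f\<^sub>i\<close> that vanishes on the line is \<open>x\<^sub>2\<close> times an element of degree
  \<open>d - 1\<close> of the saturation, and that element is zero.
\<close>

lemma restriction_independent:
  assumes f: "complete_net d f" "last_line_free f" and d: "1 \<le> d"
    and rel: "(\<Sum>i\<in>UNIV. Const (c i) * kill 2 (f i)) = 0"
  shows "c i = 0"
proof -
  let ?p = "\<Sum>i\<in>UNIV. Const (c i) * f i"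
  have "kill 2 ?p = 0" using rel by simp
  then have "Var 2 dvd ?p" unfolding Var_dvd_iff .
  then obtain b where b: "?p = Var 2 * b" by (rule dvdE)
  have Suc: "Suc (d - 1) = d" using d by simp
  have "is_form (Suc (d - 1)) (Var 2 * b)"
    unfolding Suc b[symmetric]
    by (intro is_form_sum is_form_Const_mult complete_net_form[OF f(1)])
  then have form: "is_form (d - 1) b" by (rule is_form_Var_cancel)
  have "sat_mem f (Var 2 * b)"
    unfolding b[symmetric] by (intro sat_mem_base_ideal base_idealI)
  then have "sat_mem f b" by (rule sat_mem_cancel_Var_2[OF f(2)])
  then have "b = 0"
    using d by (intro complete_net_sat_less[OF f(1) _ form]) auto
  then have "?p = 0" using b by simp
  then show ?thesis by (rule complete_net_indep[OF f(1)])
qed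

lemma finite_card_binary_monomials:
  shows "finite {m. mon_degree m = n \<and> expo m 2 = 0}" (is "finite ?E")
    and "card {m. mon_degree m = n \<and> expo m 2 = 0} \<le> n + 1"
proof -
  let ?g = "\<lambda>i. Poly_Mapping.single (0 :: 3) i + Poly_Mapping.single 1 (n - i)"
  have sub: "?E \<subseteq> ?g ` {..n}"
  proof
    fix m assume m: "m \<in> ?E"
    have "m = ?g (expo m 0)"
    proof (rule poly_mapping_eqI)
      fix i show "expo m i = expo (?g (expo m 0)) i"
        using exhaust_3[of i] m by (auto simp: mon_degree_eq lookup_add lookup_single)
    qed
    moreover have "expo m 0 \<le> n" using m by (auto simp: mon_degree_eq)
    ultimately show "m \<in> ?g ` {..n}" by blast
  qed
  then show "finite ?E" by (rule finite_subset) simp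
  have "card ?E \<le> card (?g ` {..n})" using sub by (intro card_mono) auto
  also have "\<dots> \<le> n + 1" using card_image_le[of "{..n}" ?g] by simp
  finally show "card ?E \<le> n + 1" .
qed

lemma sum_UNIV_prod_bool:
  "(\<Sum>x\<in>(UNIV :: (3 \<times> bool) set). F x) = (\<Sum>s\<in>UNIV. F (s, True) + F (s, False) :: 'b::comm_monoid_add)"
proof -
  have "(\<Sum>x\<in>(UNIV :: (3 \<times> bool) set). F x) = (\<Sum>s\<in>UNIV. \<Sum>t\<in>UNIV. F (s, t))"
    by (simp add: sum.cartesian_product)
  then show ?thesis by (simp add: UNIV_bool add.commute)
qed

text \<open>
  Six vectors in the space of binary forms of degree \<open>d + 1\<close>, which has dimension \<open>d + 2 \<le> 6\<close>: they
  are dependent or, which is possible only for \<open>d = 4\<close>, they span it.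
\<close>

lemma linear_syzygy_or_all_forms:
  fixes f :: "3 \<Rightarrow> 'k::field poly3"
  assumes f: "\<And>i. is_form d (f i)" and d: "d \<le> 4"
  shows "(\<exists>a b s. (a s \<noteq> 0 \<or> b s \<noteq> 0) \<and>
      (\<Sum>s\<in>UNIV. (Const (a s) * Var 0 + Const (b s) * Var 1) * kill 2 (f s)) = 0)
    \<or> (\<forall>p. is_form (d + 1) p \<longrightarrow> p \<in> mod_last f)"
proof (rule disjCI)
  assume not_all: "\<not> (\<forall>p. is_form (d + 1) p \<longrightarrow> p \<in> mod_last f)"
  note J = is_ideal_mod_last[of f]
  define E where "E = {m. mon_degree m = d + 1 \<and> expo m 2 = 0}"
  have E: "finite E" "card E \<le> d + 2"
    using finite_card_binary_monomials[of "d + 1"] by (simp_all add: E_def)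
  define v where "v = (\<lambda>(s, t). (if t then Var 0 else Var 1) * kill 2 (f s))"
  have keysI: "Poly_Mapping.keys p \<subseteq> E" if "is_form (d + 1) p" "kill 2 p = p" for p :: "'k poly3"
  proof
    fix m assume "m \<in> Poly_Mapping.keys p"
    then have m: "coeff3 p m \<noteq> 0" by (simp add: in_keys_iff)
    then have "expo m 2 = 0" using coeff3_kill[of 2 p m] that(2) by (simp split: if_splits)
    moreover have "mon_degree m = d + 1" using that(1) m unfolding is_form_iff by blast
    ultimately show "m \<in> E" by (simp add: E_def)
  qed
  have kill_form: "is_form d (kill 2 (f s))" for s
    using is_form_subst3[OF f, of "Suc 0" "Var(2 := 0)"] by simp
  have v: "Poly_Mapping.keys (v x) \<subseteq> E" for x
  proof (cases x)
    case (Pair s t)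
    have "is_form (Suc 0 + d) (Var i * kill 2 (f s))" for i
      by (rule is_form_mult[OF is_form_Var kill_form])
    then show ?thesis
      by (intro keysI) (auto simp: v_def Pair)
  qed
  have split: "(\<Sum>x\<in>UNIV. Const (c x) * v x)
      = (\<Sum>s\<in>UNIV. (Const (c (s, True)) * Var 0 + Const (c (s, False)) * Var 1) * kill 2 (f s))" for c
    unfolding sum_UNIV_prod_bool by (simp add: v_def distrib_right mult.assoc)
  have "\<exists>c x. c x \<noteq> 0 \<and> (\<Sum>x\<in>UNIV. Const (c x) * v x) = 0"
  proof (cases "d = 4")
    case False
    then have "card E < CARD(3 \<times> bool)" using d E(2) by simp
    then show ?thesis using dependent_family[of E v] E(1) v by metis
  next
    case True
    \<comment> \<open>A missing monomial is a seventh vector in the six-dimensional space; in a relation its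
      coefficient vanishes.\<close>
    have "\<exists>m. mon_degree m = d + 1 \<and> Poly_Mapping.single m (1 :: 'k) \<notin> mod_last f"
      using not_all form_in_ideal[OF J] by blast
    then obtain m where m: "mon_degree m = d + 1" "Poly_Mapping.single m (1 :: 'k) \<notin> mod_last f"
      by blast
    let ?w = "kill 2 (Poly_Mapping.single m (1 :: 'k))"
    have w: "?w \<notin> mod_last f" using m(2) by (simp only: kill_2_mod_last not_False_eq_True)
    have "is_form (d + 1) ?w"
      using is_form_subst3[of "d + 1" "Poly_Mapping.single m (1 :: 'k)" "Suc 0" "Var(2 := 0)"] m(1)
      by (simp add: is_form_single)
    then have "Poly_Mapping.keys ?w \<subseteq> E" by (rule keysI[OF _ kill_kill])
    then have "Poly_Mapping.keys (case_option ?w v x) \<subseteq> E" for x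
      using v by (cases x) simp_all
    moreover have "card E < CARD((3 \<times> bool) option)"
      using E(2) True by (simp add: card_UNIV_option)
    ultimately obtain a x where a: "a x \<noteq> 0" "(\<Sum>x\<in>UNIV. Const (a x) * case_option ?w v x) = 0"
      using dependent_family[of E "case_option ?w v"] E(1) by blast
    have sum: "Const (a None) * ?w + (\<Sum>x\<in>UNIV. Const (a (Some x)) * v x) = 0"
      using a(2) unfolding UNIV_option_conv by (simp add: sum.reindex)
    have "a None = 0"
    proof (rule ccontr)
      assume nz: "a None \<noteq> 0"
      have "kill 2 (f s) \<in> mod_last f" for s
        unfolding kill_2_mod_last by (intro base_ideal_mod_last base_ideal_gen)
      then have "v x \<in> mod_last f" for x
        unfolding v_def by (cases x) (simp add: is_ideal_mult[OF J])
      then have sumJ: "(\<Sum>x\<in>UNIV. Const (a (Some x)) * v x) \<in> mod_last f"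
        by (intro is_ideal_sum[OF J] is_ideal_mult[OF J])
      have eq: "Const (a None) * ?w = - (\<Sum>x\<in>UNIV. Const (a (Some x)) * v x)"
        using sum by (simp only: eq_neg_iff_add_eq_0)
      have "Const (inverse (a None)) * (Const (a None) * ?w) \<in> mod_last f"
        unfolding eq by (rule is_ideal_mult[OF J is_ideal_uminus[OF J sumJ]])
      also have "Const (inverse (a None)) * (Const (a None) * ?w) = ?w"
        unfolding mult.assoc[symmetric] Const.mult[symmetric] using nz by simp
      finally show False using w by contradiction
    qed
    then have "(\<Sum>x\<in>UNIV. Const (a (Some x)) * v x) = 0" using sum by simp
    moreover obtain y where "a (Some y) \<noteq> 0" using a(1) \<open>a None = 0\<close> by (cases x) auto
    ultimately show ?thesis by (intro exI[of _ "\<lambda>x. a (Some x)"] exI[of _ y] conjI)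
  qed
  then obtain c x where "c x \<noteq> 0" and c: "(\<Sum>x\<in>UNIV. Const (c x) * v x) = 0"
    by blast
  moreover obtain s t where "x = (s, t)" by (rule prod.exhaust)
  ultimately have "c (s, t) \<noteq> 0" by simp
  then have "c (s, True) \<noteq> 0 \<or> c (s, False) \<noteq> 0" by (cases t) auto
  then show "\<exists>a b s. (a s \<noteq> 0 \<or> b s \<noteq> 0) \<and>
      (\<Sum>s\<in>UNIV. (Const (a s) * Var 0 + Const (b s) * Var 1) * kill 2 (f s)) = 0"
    using c unfolding split
    by (intro exI[of _ "\<lambda>s. c (s, True)"] exI[of _ "\<lambda>s. c (s, False)"] exI[of _ s]) auto
qed

text \<open>
  Induction on the degree of \<open>h\<close>: beyond degree \<open>d\<close>, \<open>h\<close> differs from some \<open>x\<^sub>2 b\<close> by an element of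
  \<open>I\<close>, and \<open>b\<close> is again in the saturation.
\<close>

lemma saturated_if_all_forms:
  assumes f: "complete_net d f" "last_line_free f"
    and all: "\<And>p. is_form (d + 1) p \<Longrightarrow> p \<in> mod_last f"
    and "is_form n h" "sat_mem f h"
  shows "h \<in> base_ideal f"
  using assms(4,5)
proof (induction n arbitrary: h)
  case 0
  then show ?case using complete_net_sat[OF f(1)] by blast
next
  case (Suc n)
  note I = is_ideal_base_ideal[of f]
  show ?case
  proof (cases "Suc n \<le> d")
    case True
    then show ?thesis using complete_net_sat[OF f(1) _ Suc.prems] by simp
  next
    case False
    then have "is_form (d + 1 + (n - d)) h" using Suc.prems(1) by simp
    then have "h \<in> mod_last f" using forms_in_ideal_ge[OF is_ideal_mod_last all] by blast
    then obtain b where "h - Var 2 * b \<in> base_ideal f" unfolding mod_last_def by blast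
    then have "form_part (Suc n) (h - Var 2 * b) \<in> base_ideal f"
      by (rule form_part_base_ideal[OF complete_net_form[OF f(1)]])
    moreover have "form_part (n + Suc 0) (b * Var 2) = form_part n b * Var 2"
      by (rule form_part_mult[OF is_form_Var])
    ultimately have h: "h - Var 2 * form_part n b \<in> base_ideal f"
      using Suc.prems(1) by (simp add: form_part_diff form_part_form mult.commute)
    have "sat_mem f (h - (h - Var 2 * form_part n b))"
      by (intro sat_mem_diff Suc.prems sat_mem_base_ideal h)
    then have "sat_mem f (Var 2 * form_part n b)" by simp
    then have "sat_mem f (form_part n b)" by (rule sat_mem_cancel_Var_2[OF f(2)])
    then have "form_part n b \<in> base_ideal f" by (intro Suc.IH) simp_all
    then have "Var 2 * form_part n b \<in> base_ideal f" by (rule is_ideal_mult[OF I])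
    with h show ?thesis using is_ideal_add[OF I] by (metis diff_add_cancel)
  qed
qed

section \<open>A linear syzygy\<close>

text \<open>
  Let \<open>L = (x\<^sub>0, x\<^sub>1, \<gamma> x\<^sub>2)\<close> be the syzygy. Exactness of the Koszul complex would give
  \<open>f = L \<times> g\<close>; all that it takes is \<open>f\<^sub>2 \<in> (x\<^sub>0, x\<^sub>1)\<close>. For \<open>\<gamma> \<noteq> 0\<close> this follows from the relation
  itself. For \<open>\<gamma> = 0\<close> it gives \<open>f\<^sub>0 = x\<^sub>1 q\<close> and \<open>f\<^sub>1 = - x\<^sub>0 q\<close>; if \<open>f\<^sub>2\<close> involved a power of \<open>x\<^sub>2\<close>
  alone, then \<open>q\<close>, of degree \<open>d - 1\<close>, would lie in the saturation and
  vanish.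

  With \<open>f = L \<times> g\<close> and coprime restrictions, every syzygy of the restricted forms is a combination
  of the restrictions of \<open>L\<close> and \<open>g\<close>, so it lifts. A relation \<open>x\<^sub>2 p = \<Sum> a\<^sub>i f\<^sub>i\<close> restricts to such
  a syzygy; subtracting its lift makes the \<open>a\<^sub>i\<close> divisible by \<open>x\<^sub>2\<close>, and \<open>p \<in> I\<close>.
\<close>

lemma hilbert_burch:
  fixes f :: "3 \<Rightarrow> 'k::field poly3"
  assumes f: "complete_net d f" "last_line_free f" and d: "1 \<le> d"
    and syz: "Var 0 * f 0 + Var 1 * f 1 + Const \<gamma> * Var 2 * f 2 = 0"
    and h: "sat_mem f h"
  shows "h \<in> base_ideal f"
proof -
  note I = is_ideal_base_ideal[of f]
  define \<Gamma> where "\<Gamma> = Const \<gamma> * Var 2"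
  define w where "w = (Var(0 := 0, 1 := 0) :: 3 \<Rightarrow> 'k poly3)"
  have w [simp]: "w 0 = 0" "w 1 = 0" "w 2 = Var 2" by (simp_all add: w_def)
  obtain A where "f 2 - subst3 w (f 2) = (\<Sum>i\<in>UNIV. A i * (Var i - w i))"
    using diff_subst3 by blast
  then have A: "f 2 = subst3 w (f 2) + A 0 * Var 0 + A 1 * Var 1"
    by (simp add: sum_UNIV_3 algebra_simps)
  \<comment> \<open>The part of \<open>f\<^sub>2\<close> that involves neither \<open>x\<^sub>0\<close> nor \<open>x\<^sub>1\<close> vanishes.\<close>
  have "subst3 w (f 2) = 0"
  proof (cases "\<gamma> = 0")
    case False
    have "subst3 w (Var 0 * f 0 + Var 1 * f 1 + Const \<gamma> * Var 2 * f 2) = 0" unfolding syz by simp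
    then show ?thesis using False by simp
  next
    case True
    then have rel: "Var 0 * f 0 = Var 1 * (- f 1)" using syz by (simp add: eq_neg_iff_add_eq_0)
    then have "Var 1 dvd f 0" by (intro Var_dvd_cancel_Var[of 1 "- f 1" 0]) auto
    then obtain q where q0: "f 0 = Var 1 * q" by (elim dvdE)
    then have "Var 1 * (Var 0 * q) = Var 1 * (- f 1)" using rel by (simp add: mult_ac)
    then have q1: "f 1 = - (Var 0 * q)"
      by (simp only: mult_cancel_left Var_neq_0 simp_thms) simp
    have "is_form (Suc (d - 1)) (Var 1 * q)"
      using complete_net_form[OF f(1), of 0] d q0 by simp
    then have form: "is_form (d - 1) q" by (rule is_form_Var_cancel)
    define c where "c = eval3 (\<lambda>x. x) (\<lambda>i. if i = 2 then 1 else 0) (f 2)"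
    have "w = (\<lambda>i. Const (if i = 2 then 1 else 0) * Var 2)"
      by (rule ext) (use exhaust_3 in \<open>auto simp: w_def\<close>)
    then have c: "subst3 w (f 2) = Const c * Var 2 ^ d"
      using subst3_point_line[OF complete_net_form[OF f(1)]] by (simp add: c_def)
    have "c = 0"
    proof (rule ccontr)
      assume "c \<noteq> 0"
      have x0: "Var 0 * q \<in> base_ideal f"
        using is_ideal_uminus[OF I base_ideal_gen, of 1] q1 by simp
      have x1: "Var 1 * q \<in> base_ideal f"
        using base_ideal_gen[of f 0] q0 by simp
      have "q * f 2 - A 0 * (Var 0 * q) - A 1 * (Var 1 * q) \<in> base_ideal f"
        by (intro is_ideal_diff[OF I] is_ideal_mult[OF I] x0 x1 base_ideal_gen)
      also have "q * f 2 - A 0 * (Var 0 * q) - A 1 * (Var 1 * q) = q * (f 2 - A 0 * Var 0 - A 1 * Var 1)"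
        by (simp add: algebra_simps)
      also have "f 2 - A 0 * Var 0 - A 1 * Var 1 = Const c * Var 2 ^ d"
        using A c by (simp add: algebra_simps)
      finally have "Const (inverse c) * (q * (Const c * Var 2 ^ d)) \<in> base_ideal f"
        by (rule is_ideal_mult[OF I])
      also have "Const (inverse c) * (q * (Const c * Var 2 ^ d)) = Const (inverse c * c) * (Var 2 ^ d * q)"
        by (simp only: Const.mult mult_ac)
      also have "\<dots> = Var 2 ^ d * q" using \<open>c \<noteq> 0\<close> by simp
      finally have x2: "Var 2 ^ d * q \<in> base_ideal f" .
      have "\<exists>n. Var i ^ n * q \<in> base_ideal f" for i
        using exhaust_3[of i] x0 x1 x2 power_one_right by metis
      then have "sat_mem f q" by (rule sat_memI_Var_powers)
      then have "q = 0"
        using d by (intro complete_net_sat_less[OF f(1) _ form]) auto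
      then have "(\<Sum>i\<in>UNIV. Const (if i = 0 then 1 else 0) * f i) = 0"
        using q0 by (simp add: sum_UNIV_3)
      from complete_net_indep[OF f(1) this, of 0] show False by simp
    qed
    then show ?thesis by (simp add: c)
  qed
  then obtain g0 g1 where f2: "f 2 = Var 0 * g1 - Var 1 * g0"
    using A that by (metis (no_types) add_0 diff_minus_eq_add mult.commute mult_minus_right)
  have "Var 0 * (f 0 + \<Gamma> * g1) = Var 1 * (\<Gamma> * g0 - f 1)"
    using syz unfolding f2 \<Gamma>_def[symmetric] by algebra
  moreover from this have "Var 1 dvd f 0 + \<Gamma> * g1"
    by (intro Var_dvd_cancel_Var[of 1 "\<Gamma> * g0 - f 1" 0]) auto
  then obtain g2 where g2: "f 0 + \<Gamma> * g1 = Var 1 * g2" by (elim dvdE)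
  ultimately have "Var 1 * (Var 0 * g2) = Var 1 * (\<Gamma> * g0 - f 1)" by (simp add: mult_ac)
  then have "Var 0 * g2 = \<Gamma> * g0 - f 1" by (simp only: mult_cancel_left Var_neq_0 simp_thms)
  then have f1: "f 1 = \<Gamma> * g0 - Var 0 * g2" by algebra
  from g2 have f0: "f 0 = Var 1 * g2 - \<Gamma> * g1" by algebra
  define G where "G = kill 2 g2"
  define H where "H = Var 0 * kill 2 g1 - Var 1 * kill 2 g0"
  have kill_\<Gamma>: "kill 2 \<Gamma> = 0" by (simp add: \<Gamma>_def)
  have kill_f: "kill 2 (f 0) = Var 1 * G" "kill 2 (f 1) = - (Var 0 * G)" "kill 2 (f 2) = H"
    by (simp_all add: f0 f1 f2 kill_\<Gamma> G_def H_def)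
  have "G \<noteq> 0"
  proof
    assume "G = 0"
    then have "(\<Sum>i\<in>UNIV. Const (if i = 0 then 1 else 0) * kill 2 (f i)) = 0"
      using kill_f by (simp add: sum_UNIV_3)
    from restriction_independent[OF f d this, of 0] show False by simp
  qed
  obtain M where M: "\<And>p. is_form M p \<Longrightarrow> p \<in> mod_last f"
    using f(2) unfolding last_line_free_def by blast
  \<comment> \<open>\<open>G\<close> and \<open>H\<close> are coprime: modulo them a power of \<open>x\<^sub>0\<close> and a power of \<open>x\<^sub>1\<close> vanish.\<close>
  have power_comb: "\<exists>\<alpha> \<beta>. Var i ^ M = \<alpha> * G + \<beta> * H" if "i \<noteq> 2" for i
  proof -
    have "Var i ^ M \<in> mod_last f" by (intro M is_form_Var_power)
    then obtain b where "Var i ^ M - Var 2 * b \<in> base_ideal f" unfolding mod_last_def by blast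
    then obtain \<alpha> where "Var i ^ M - Var 2 * b = (\<Sum>j\<in>UNIV. \<alpha> j * f j)" by (rule base_idealE)
    then have "kill 2 (Var i ^ M - Var 2 * b) = kill 2 (\<Sum>j\<in>UNIV. \<alpha> j * f j)" by simp
    then have "Var i ^ M = kill 2 (\<alpha> 0) * (Var 1 * G) - kill 2 (\<alpha> 1) * (Var 0 * G) + kill 2 (\<alpha> 2) * H"
      using that by (simp add: sum_UNIV_3 kill_f)
    then have "Var i ^ M = (kill 2 (\<alpha> 0) * Var 1 - kill 2 (\<alpha> 1) * Var 0) * G + kill 2 (\<alpha> 2) * H"
      by (simp add: algebra_simps)
    then show ?thesis by blast
  qed
  \<comment> \<open>\<open>x\<^sub>2\<close> is a nonzerodivisor modulo the ideal.\<close>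
  have cancel: "p \<in> base_ideal f" if p: "Var 2 * p \<in> base_ideal f" for p
  proof -
    from p obtain a where a: "Var 2 * p = (\<Sum>j\<in>UNIV. a j * f j)" by (rule base_idealE)
    have "kill 2 (Var 2 * p) = kill 2 (\<Sum>j\<in>UNIV. a j * f j)" by (simp only: a)
    then have rel: "kill 2 (a 2) * H = G * (kill 2 (a 1) * Var 0 - kill 2 (a 0) * Var 1)"
      by (simp add: sum_UNIV_3 kill_f) algebra
    have G_dvd: "G dvd kill 2 (a 2) * Var i ^ M" if i: "i \<noteq> 2" for i
    proof -
      obtain \<alpha> \<beta> where "Var i ^ M = \<alpha> * G + \<beta> * H" using power_comb[OF i] by blast
      then have "kill 2 (a 2) * Var i ^ M = G * (kill 2 (a 2) * \<alpha>) + \<beta> * (kill 2 (a 2) * H)"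
        by (simp add: algebra_simps)
      also have "\<dots> = G * (kill 2 (a 2) * \<alpha> + \<beta> * (kill 2 (a 1) * Var 0 - kill 2 (a 0) * Var 1))"
        unfolding rel by (simp add: algebra_simps)
      finally have "kill 2 (a 2) * Var i ^ M
          = G * (kill 2 (a 2) * \<alpha> + \<beta> * (kill 2 (a 1) * Var 0 - kill 2 (a 0) * Var 1))" .
      then show ?thesis by simp
    qed
    obtain r0 where r0: "kill 2 (a 2) * Var 0 ^ M = G * r0" using G_dvd[of 0] by (auto elim: dvdE)
    obtain r1 where r1: "kill 2 (a 2) * Var 1 ^ M = G * r1" using G_dvd[of 1] by (auto elim: dvdE)
    have "G * (Var 1 ^ M * r0) = kill 2 (a 2) * Var 0 ^ M * Var 1 ^ M"
      unfolding r0 by (simp only: mult_ac)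
    also have "\<dots> = kill 2 (a 2) * Var 1 ^ M * Var 0 ^ M" by (simp only: mult_ac)
    also have "\<dots> = G * (Var 0 ^ M * r1)" unfolding r1 by (simp only: mult_ac)
    finally have "G * (Var 1 ^ M * r0) = G * (Var 0 ^ M * r1)" .
    then have "Var 1 ^ M * r0 = Var 0 ^ M * r1" using \<open>G \<noteq> 0\<close> mult_left_cancel by blast
    then have "Var 0 ^ M dvd Var 1 ^ M * r0" by simp
    then have "Var 0 ^ M dvd r0" by (rule Var_power_dvd_cancel) simp
    then obtain v where "r0 = Var 0 ^ M * v" by (elim dvdE)
    then have "Var 0 ^ M * kill 2 (a 2) = Var 0 ^ M * (v * G)" using r0 by (simp add: mult_ac)
    then have v: "kill 2 (a 2) = v * G" by (simp only: mult_cancel_left power_eq_0_iff Var_neq_0 simp_thms)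
    have "G * (Var 0 * (kill 2 (a 1) - v * kill 2 g1)) = G * (Var 1 * (kill 2 (a 0) - v * kill 2 g0))"
      using rel unfolding v H_def by algebra
    then have "Var 0 * (kill 2 (a 1) - v * kill 2 g1) = Var 1 * (kill 2 (a 0) - v * kill 2 g0)"
      using \<open>G \<noteq> 0\<close> mult_left_cancel by blast
    moreover from this have "Var 0 dvd kill 2 (a 0) - v * kill 2 g0"
      by (rule Var_dvd_cancel_Var) simp
    then obtain u where u: "kill 2 (a 0) - v * kill 2 g0 = Var 0 * u" by (elim dvdE)
    ultimately have "Var 0 * (kill 2 (a 1) - v * kill 2 g1) = Var 0 * (Var 1 * u)" by (simp add: mult_ac)
    then have u1: "kill 2 (a 1) - v * kill 2 g1 = Var 1 * u" by (simp only: mult_cancel_left Var_neq_0 simp_thms)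
    obtain a0 where a0: "a 0 = kill 2 (a 0) + Var 2 * a0" by (rule kill_decomp)
    obtain a1 where a1: "a 1 = kill 2 (a 1) + Var 2 * a1" by (rule kill_decomp)
    obtain a2 where a2: "a 2 = kill 2 (a 2) + Var 2 * a2" by (rule kill_decomp)
    obtain b0 where b0: "g0 = kill 2 g0 + Var 2 * b0" by (rule kill_decomp)
    obtain b1 where b1: "g1 = kill 2 g1 + Var 2 * b1" by (rule kill_decomp)
    obtain b2 where b2: "g2 = G + Var 2 * b2" unfolding G_def by (rule kill_decomp)
    \<comment> \<open>The coefficients are \<open>v g + u L\<close>, a syzygy in the plane, up to multiples of \<open>x\<^sub>2\<close>.\<close>
    have A0: "a 0 = v * g0 + u * Var 0 + Var 2 * (a0 - v * b0)"
      using a0 b0 u by algebra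
    have A1: "a 1 = v * g1 + u * Var 1 + Var 2 * (a1 - v * b1)"
      using a1 b1 u1 by algebra
    have A2: "a 2 = v * g2 + u * \<Gamma> + Var 2 * (a2 - v * b2 - u * Const \<gamma>)"
      using a2 b2 v unfolding \<Gamma>_def by algebra
    have gf: "g0 * f 0 + g1 * f 1 + g2 * f 2 = 0" unfolding f0 f1 f2 by algebra
    have syz': "Var 0 * f 0 + Var 1 * f 1 + \<Gamma> * f 2 = 0" using syz by (simp add: \<Gamma>_def)
    have "Var 2 * p = a 0 * f 0 + a 1 * f 1 + a 2 * f 2" using a by (simp add: sum_UNIV_3)
    also have "\<dots> = v * (g0 * f 0 + g1 * f 1 + g2 * f 2) + u * (Var 0 * f 0 + Var 1 * f 1 + \<Gamma> * f 2)
        + Var 2 * ((a0 - v * b0) * f 0 + (a1 - v * b1) * f 1 + (a2 - v * b2 - u * Const \<gamma>) * f 2)"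
      unfolding A0 A1 A2 by algebra
    finally have "Var 2 * p = Var 2 * ((a0 - v * b0) * f 0 + (a1 - v * b1) * f 1
        + (a2 - v * b2 - u * Const \<gamma>) * f 2)"
      unfolding gf syz' by simp
    then have "p = (a0 - v * b0) * f 0 + (a1 - v * b1) * f 1 + (a2 - v * b2 - u * Const \<gamma>) * f 2"
      by (simp only: mult_cancel_left Var_neq_0 simp_thms)
    then show ?thesis
      by (auto intro!: is_ideal_add[OF I] is_ideal_mult[OF I] base_ideal_gen)
  qed
  obtain N where "\<And>p. is_form N p \<Longrightarrow> p * h \<in> base_ideal f"
    using h unfolding sat_mem_def by blast
  then have "Var 2 ^ N * h \<in> base_ideal f" by simp
  then show ?thesis
  proof (induction N)
    case (Suc N)
    then show ?case using cancel[of "Var 2 ^ N * h"] by (simp add: mult.assoc)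
  qed simp
qed

lemma last_line_free_linear_change:
  assumes A: "linear_change A B" "A 2 = Var 2" and "last_line_free f"
  shows "last_line_free (\<lambda>i. subst3 A (f i))"
proof -
  obtain M where M: "\<And>p. is_form M p \<Longrightarrow> p \<in> mod_last f"
    using assms(3) unfolding last_line_free_def by blast
  have "p \<in> mod_last (\<lambda>i. subst3 A (f i))" if "is_form M p" for p
  proof -
    have "subst3 B p \<in> mod_last f"
      by (intro M linear_change_form[OF linear_change_sym[OF A(1)]] that)
    then obtain b where "subst3 B p - Var 2 * b \<in> base_ideal f" unfolding mod_last_def by blast
    then have "subst3 A (subst3 B p - Var 2 * b) \<in> base_ideal (\<lambda>i. subst3 A (f i))"
      by (rule base_ideal_subst3)
    then have "p - Var 2 * subst3 A b \<in> base_ideal (\<lambda>i. subst3 A (f i))"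
      by (simp add: A(2) linear_change_inverse[OF A(1)])
    then show ?thesis by (rule mod_lastI)
  qed
  then show ?thesis unfolding last_line_free_def by blast
qed

lemma third_index:
  assumes "s \<noteq> (t :: 3)"
  obtains u where "s \<noteq> u" "t \<noteq> u" "UNIV = {s, t, u}"
proof -
  have "s \<noteq> 0 \<and> t \<noteq> 0 \<or> s \<noteq> 1 \<and> t \<noteq> 1 \<or> s \<noteq> 2 \<and> t \<noteq> 2"
    using exhaust_3[of s] exhaust_3[of t] assms by auto
  then obtain u where u: "s \<noteq> u" "t \<noteq> u" by blast
  then have "card {s, t, u} = card (UNIV :: 3 set)" using assms by simp
  from card_subset_eq[OF finite subset_UNIV this] u show thesis using that by metis
qed

text \<open>
  If \<open>L = \<Sum> c\<^sub>i x\<^sub>i\<close>, replacing \<open>f\<^sub>s\<close> and \<open>f\<^sub>t\<close> by \<open>f\<^sub>s + c\<^sub>0 f\<^sub>u\<close> and \<open>f\<^sub>t + c\<^sub>1 f\<^sub>u\<close> reduces \<open>L\<close> to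
  \<open>c\<^sub>2 x\<^sub>2\<close> without changing the ideal.
\<close>

lemma saturated_if_reduced_syzygy:
  fixes f :: "3 \<Rightarrow> 'k::field poly3"
  assumes f: "complete_net d f" "last_line_free f" and d: "1 \<le> d"
    and stu: "s \<noteq> t" "s \<noteq> u" "t \<noteq> u" "UNIV = {s, t, u}"
    and L: "is_form (Suc 0) L" "Var 0 * f s + Var 1 * f t + L * f u = 0"
    and h: "sat_mem f h"
  shows "h \<in> base_ideal f"
proof -
  obtain c where c: "L = (\<Sum>i\<in>UNIV. Const (c i) * Var i)" using linear_form_eq[OF L(1)] by blast
  define F where "F = (\<lambda>i :: 3. if i = 0 then f s + Const (c 0) * f u
    else if i = 1 then f t + Const (c 1) * f u else f u)"
  have F: "F 0 = f s + Const (c 0) * f u" "F 1 = f t + Const (c 1) * f u" "F 2 = f u"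
    by (simp_all add: F_def)
  have "F i \<in> base_ideal f" for i
    unfolding F_def by (auto intro!: is_ideal_add is_ideal_mult is_ideal_base_ideal base_ideal_gen)
  moreover have "f i \<in> base_ideal F" for i
  proof -
    note I = is_ideal_base_ideal[of F]
    have "F 0 - Const (c 0) * F 2 \<in> base_ideal F" "F 1 - Const (c 1) * F 2 \<in> base_ideal F"
      by (intro is_ideal_diff[OF I] is_ideal_mult[OF I] base_ideal_gen)+
    then have "f s \<in> base_ideal F" "f t \<in> base_ideal F" by (simp_all add: F)
    moreover have "f u \<in> base_ideal F" using base_ideal_gen[of F 2] by (simp add: F)
    moreover have "i = s \<or> i = t \<or> i = u" using stu(4) by blast
    ultimately show ?thesis by auto
  qed
  ultimately have eq: "base_ideal F = base_ideal f"
    by (intro equalityI base_ideal_least is_ideal_base_ideal)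
  then have sat: "sat_mem F = sat_mem f" by (simp add: fun_eq_iff sat_mem_def)
  have free: "last_line_free F" using f(2) by (simp add: last_line_free_def mod_last_def eq)
  have "complete_net d F"
    unfolding complete_net_def
  proof (intro conjI allI impI)
    show "is_form d (F i)" for i
      unfolding F_def by (auto intro!: is_form_add is_form_Const_mult complete_net_form[OF f(1)])
  next
    fix b i assume b: "(\<Sum>i\<in>UNIV. Const (b i) * F i) = 0"
    let ?e = "\<lambda>i. if i = s then b 0 else if i = t then b 1 else b 0 * c 0 + b 1 * c 1 + b 2"
    have "(\<Sum>i\<in>UNIV. Const (?e i) * f i) = Const (?e s) * f s + Const (?e t) * f t + Const (?e u) * f u"
      unfolding stu(4) using stu(1-3) by (simp add: add.assoc)
    also have "\<dots> = (\<Sum>i\<in>UNIV. Const (b i) * F i)"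
      unfolding sum_UNIV_3 F using stu(1-3) by (simp add: algebra_simps)
    finally have "(\<Sum>i\<in>UNIV. Const (?e i) * f i) = (\<Sum>i\<in>UNIV. Const (b i) * F i)" .
    then have "?e i = 0" for i
      using b by (intro complete_net_indep[OF f(1), of ?e i]) simp
    from this[of s] this[of t] this[of u] show "b i = 0"
      using stu(1-3) exhaust_3[of i] by auto
  next
    fix n h assume "n \<le> d" "is_form n h" "sat_mem F h"
    then show "h \<in> base_ideal F" using complete_net_sat[OF f(1)] by (simp add: eq sat)
  qed
  moreover have "Var 0 * F 0 + Var 1 * F 1 + Const (c 2) * Var 2 * F 2 = 0"
    using L(2) unfolding F c sum_UNIV_3 by algebra
  ultimately show ?thesis
    using hilbert_burch[OF _ free d, of "c 2" h] h by (simp add: eq sat)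
qed

text \<open>
  Two of the three linear forms of the lifted syzygy are independent on the line, for otherwise the
  restricted \<open>f\<^sub>i\<close> would be linearly dependent. Hence these two forms and \<open>x\<^sub>2\<close> can serve as coordinates.
\<close>

lemma saturated_if_linear_syzygy:
  fixes f :: "3 \<Rightarrow> 'k::field poly3"
  assumes f: "complete_net d f" "last_line_free f" and d: "1 \<le> d"
    and nz: "a s0 \<noteq> 0 \<or> b s0 \<noteq> 0"
    and rel: "(\<Sum>s\<in>UNIV. (Const (a s) * Var 0 + Const (b s) * Var 1) * kill 2 (f s)) = 0"
    and h: "sat_mem f h"
  shows "h \<in> base_ideal f"
proof -
  define l where "l = (\<lambda>s. Const (a s) * Var 0 + Const (b s) * Var 1)"
  \<comment> \<open>The syzygy lifts from the line to the plane.\<close>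
  have "kill 2 (\<Sum>s\<in>UNIV. l s * f s) = 0" using rel by (simp add: l_def)
  then have "Var 2 dvd (\<Sum>s\<in>UNIV. l s * f s)" unfolding Var_dvd_iff .
  then obtain q where q: "(\<Sum>s\<in>UNIV. l s * f s) = Var 2 * q" by (rule dvdE)
  have "is_form (Suc 0 + d) (Var 2 * q)"
    unfolding q[symmetric] l_def
    by (intro is_form_sum is_form_mult is_form_add is_form_Const_mult is_form_Var complete_net_form[OF f(1)])
  then have "is_form (Suc d) (Var 2 * q)" by (simp only: add_Suc add_0)
  then have form: "is_form d q" by (rule is_form_Var_cancel)
  have "sat_mem f (Var 2 * q)" unfolding q[symmetric] by (intro sat_mem_base_ideal base_idealI)
  then have "sat_mem f q" by (rule sat_mem_cancel_Var_2[OF f(2)])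
  then have "q \<in> base_ideal f"
    by (rule complete_net_sat[OF f(1) order_refl form])
  then obtain c where c: "q = (\<Sum>s\<in>UNIV. Const (c s) * f s)"
    using form_in_base_ideal_0[where f = f, OF complete_net_form[OF f(1)] form] by blast
  define L where "L = (\<lambda>s. l s - Const (c s) * Var 2)"
  have syz: "(\<Sum>s\<in>UNIV. L s * f s) = 0"
  proof -
    have "(\<Sum>s\<in>UNIV. L s * f s) = (\<Sum>s\<in>UNIV. l s * f s) - Var 2 * (\<Sum>s\<in>UNIV. Const (c s) * f s)"
      by (simp only: L_def left_diff_distrib sum_subtractf sum_distrib_left mult.assoc mult.left_commute[of "Var 2"])
    then show ?thesis unfolding q c by simp
  qed
  have L_form: "is_form (Suc 0) (L s)" for s
    unfolding L_def l_def by (intro is_form_diff is_form_add is_form_Const_mult is_form_Var)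
  have "\<exists>s t. a s * b t - a t * b s \<noteq> 0"
  proof (rule ccontr)
    assume "\<not> ?thesis"
    then have minor: "a s * b s0 = a s0 * b s" for s by simp
    have "\<exists>g. \<forall>s. a s = g s * a s0 \<and> b s = g s * b s0"
    proof (cases "a s0 = 0")
      case True
      then have "a s = 0" for s using minor[of s] nz by simp
      then show ?thesis using True nz by (intro exI[of _ "\<lambda>s. b s / b s0"]) simp
    next
      case False
      then show ?thesis
        using minor by (intro exI[of _ "\<lambda>s. a s / a s0"]) (simp add: field_simps)
    qed
    then obtain g where g: "\<And>s. a s = g s * a s0" "\<And>s. b s = g s * b s0" by blast
    have "l s = l s0 * Const (g s)" for s
      unfolding l_def by (subst g(1), subst g(2)) (simp add: algebra_simps)
    then have "(\<Sum>s\<in>UNIV. l s * kill 2 (f s)) = (\<Sum>s\<in>UNIV. l s0 * Const (g s) * kill 2 (f s))"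
      by (intro sum.cong) metis+
    then have "l s0 * (\<Sum>s\<in>UNIV. Const (g s) * kill 2 (f s)) = 0"
      using rel by (simp add: l_def sum_distrib_left mult.assoc)
    moreover have "l s0 \<noteq> 0"
    proof
      assume "l s0 = 0"
      let ?c = "\<lambda>i :: 3. if i = 0 then a s0 else if i = 1 then b s0 else 0"
      have "(\<Sum>i\<in>UNIV. Const (?c i) * Var i) = 0" using \<open>l s0 = 0\<close> by (simp add: sum_UNIV_3 l_def)
      from linear_form_eq_0[OF this, of 0] linear_form_eq_0[OF this, of 1] show False using nz by simp
    qed
    ultimately have "(\<Sum>s\<in>UNIV. Const (g s) * kill 2 (f s)) = 0" by simp
    then have "g s0 = 0" by (rule restriction_independent[OF f d])
    then show False using g[of s0] nz by simp
  qed
  then obtain s t where minor: "a s * b t - a t * b s \<noteq> 0" by blast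
  then have "s \<noteq> t" by auto
  then obtain u where stu: "s \<noteq> u" "t \<noteq> u" "UNIV = {s, t, u}" by (rule third_index)
  define k where "k = Const (inverse (a s * b t - a t * b s))"
  have k: "k * (Const (a s) * Const (b t) - Const (a t) * Const (b s)) = 1"
    unfolding k_def Const.mult[symmetric] Const.diff[symmetric] using minor by simp
  \<comment> \<open>New coordinates in which \<open>L s\<close>, \<open>L t\<close> and the last variable are the variables.\<close>
  define B where "B = (\<lambda>i :: 3. if i = 0 then L s else if i = 1 then L t else Var 2)"
  define A where "A = (\<lambda>i :: 3.
    if i = 0 then k * (Const (b t) * (Var 0 + Const (c s) * Var 2) - Const (b s) * (Var 1 + Const (c t) * Var 2))
    else if i = 1 then k * (Const (a s) * (Var 1 + Const (c t) * Var 2) - Const (a t) * (Var 0 + Const (c s) * Var 2))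
    else Var 2)"
  have A_simps: "A 0 = k * (Const (b t) * (Var 0 + Const (c s) * Var 2) - Const (b s) * (Var 1 + Const (c t) * Var 2))"
    "A 1 = k * (Const (a s) * (Var 1 + Const (c t) * Var 2) - Const (a t) * (Var 0 + Const (c s) * Var 2))"
    "A 2 = Var 2" by (simp_all add: A_def)
  have B_simps: "B 0 = L s" "B 1 = L t" "B 2 = Var 2" by (simp_all add: B_def)
  have subst_k: "subst3 v k = k" for v by (simp add: k_def)
  have AL: "subst3 A (L s) = Var 0" "subst3 A (L t) = Var 1"
  proof -
    show "subst3 A (L s) = Var 0"
      unfolding L_def l_def using k by (simp add: A_simps) algebra
    show "subst3 A (L t) = Var 1"
      unfolding L_def l_def using k by (simp add: A_simps) algebra
  qed
  have BA: "subst3 B (A 0) = Var 0" "subst3 B (A 1) = Var 1"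
  proof -
    show "subst3 B (A 0) = Var 0"
      unfolding A_simps using k by (simp add: subst_k B_simps L_def l_def) algebra
    show "subst3 B (A 1) = Var 1"
      unfolding A_simps using k by (simp add: subst_k B_simps L_def l_def) algebra
  qed
  have A_form: "is_form (Suc 0) (A i)" for i
    unfolding A_def k_def
    by (auto intro!: is_form_Const_mult is_form_diff is_form_add)
  have "subst3 A (B i) = Var i \<and> subst3 B (A i) = Var i" for i
    using exhaust_3[of i] AL BA by (auto simp: B_simps A_simps(3))
  then have change: "linear_change A B"
    unfolding linear_change_def using A_form L_form by (auto simp: B_def)
  show ?thesis
  proof (rule saturated_linear_change[OF change _ h])
    fix h assume h: "sat_mem (\<lambda>i. subst3 A (f i)) h"
    show "h \<in> base_ideal (\<lambda>i. subst3 A (f i))"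
    proof (rule saturated_if_reduced_syzygy[OF _ _ d \<open>s \<noteq> t\<close> stu _ _ h])
      show "complete_net d (\<lambda>i. subst3 A (f i))" by (rule complete_net_linear_change[OF change f(1)])
      show "last_line_free (\<lambda>i. subst3 A (f i))"
        by (rule last_line_free_linear_change[OF change A_simps(3) f(2)])
      show "is_form (Suc 0) (subst3 A (L u))" by (rule linear_change_form[OF change L_form])
      have "subst3 A (L s * f s + L t * f t + L u * f u) = 0"
        using syz \<open>s \<noteq> t\<close> stu(1,2) unfolding stu(3) by (simp add: add.assoc)
      then show "Var 0 * subst3 A (f s) + Var 1 * subst3 A (f t) + subst3 A (L u) * subst3 A (f u) = 0"
        by (simp add: AL)
    qed
  qed
qed

section \<open>Base ideals of degree at most four\<close>

theorem corollary1p23: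
  fixes I :: "'k::alg_closed_field poly3 set"
    and f :: "3 \<Rightarrow> 'k poly3"
    and d :: nat
  assumes "d \<ge> 2"
    and "plane_cremona_map d f"
    and "I = base_ideal f"
    and "d \<le> 4"
  shows "saturated I"
proof -
  have f: "complete_net d f" "no_fixed_part f" "\<exists>i. f i \<noteq> 0"
    using plane_cremona_map_complete_net[OF assms(2,1)] assms(2)
    by (auto simp: plane_cremona_map_def represents_rational_map_def)
  then obtain s where "f s \<noteq> 0" by blast
  then obtain A B where A: "linear_change A B" "last_line_free (\<lambda>i. subst3 A (f i))"
    using exists_line_free_coordinates[OF infinite_alg_closed_field complete_net_form[OF f(1)] f(2)]
    by blast
  define f' where "f' = (\<lambda>i. subst3 A (f i))"
  have f': "complete_net d f'" "last_line_free f'"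
    using complete_net_linear_change[OF A(1) f(1)] A(2) by (simp_all add: f'_def)
  have "h \<in> base_ideal f'" if h: "sat_mem f' h" for h
  proof -
    consider (syzygy) a b s where "a s \<noteq> 0 \<or> b s \<noteq> 0"
        "(\<Sum>s\<in>UNIV. (Const (a s) * Var 0 + Const (b s) * Var 1) * kill 2 (f' s)) = 0"
      | (all) "\<And>p. is_form (d + 1) p \<Longrightarrow> p \<in> mod_last f'"
      using linear_syzygy_or_all_forms[where f = f', OF complete_net_form[OF f'(1)] assms(4)] by blast
    then show ?thesis
    proof cases
      case syzygy
      then show ?thesis using assms(1) by (intro saturated_if_linear_syzygy[OF f' _ _ _ h]) auto
    next
      case all
      then show ?thesis
        using saturated_if_all_forms[OF f']
        by (intro sat_mem_forms_suffice[where f = f', OF complete_net_form[OF f'(1)] _ h]) blast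
    qed
  qed
  then have "h \<in> base_ideal f" if "sat_mem f h" for h
    using saturated_linear_change[OF A(1) _ that] unfolding f'_def by blast
  then show ?thesis unfolding assms(3) by (rule saturatedI)
qed

end
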